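(* Let $\mu>-1$ and $\mathcal K=K^1+\widetilde K^\mu H$. Assume that the equation $(I-\mathcal K)f=g$ has a unique solution $f^*\in C^0$. If $h:[-1,1]\times\mathbb R\to\mathbb R$ is continuous, $\psi\in C^0$, and $$\sup_{x\in[-1,1]}\|k_1(x,\cdot)\|_{Z^\lambda}<\infty,\qquad \lambda>0,$$ then for every $f\in C^0$ one has $\mathcal K f\in Z^s$, where $s=\min\{\lambda,\mu+1\}$ when $\mu\neq0$, while $s=\min\{\lambda,1-\epsilon\}$, with $\epsilon>0$ arbitrarily small, when $\mu=0$. Consequently, if also $g\in Z^s$, then the solution $f^*$ of the equation $(I-\mathcal K)f=g$ belongs to $Z^s$.
   Context: $C^0=C^0([-1,1])$ is the Banach space of real continuous functions on $[-1,1]$ with the norm $\|f\|_\infty=\max_{[-1,1]}|f|$. Operators, for $x,y\in[-1,1]$: $(K^1f)(y)=\int_{-1}^1k_1(x,y)f(x)\,dx$, with $k_1$ a continuous kernel on $[-1,1]^2$ (standing assumption); $(Hf)(x)=h(x,f(x))$; and $$(\widetilde K^\mu f)(y)=\begin{cases}\int_{-1}^1\psi(x)|x-y|^\mu f(x)\,dx,&\mu>-1,\ \mu\ne0,\\ \int_{-1}^1\psi(x)\log|x-y|\,f(x)\,dx,&\mu=0.\end{cases}$$ Zygmund spaces: let $\varphi(x)=\sqrt{1-x^2}$. For an integer $k\ge1$, $$\Delta^k_{\tau\varphi}f(x)=\sum_{i=0}^k(-1)^i\binom ki f\Big(x+\frac{\tau\varphi(x)}2(k-2i)\Big),\qquad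 \Omega^k_\varphi(f,t)=\sup_{0<\tau\le t}\ \max_{x\in I_{k\tau}}|\Delta^k_{\tau\varphi}f(x)|,$$ with $I_{k\tau}=[-1+(2k\tau)^2,\,1-(2k\tau)^2]$ (values of $\tau$ for which $I_{k\tau}$ is empty are disregarded). For real $\lambda>0$, with $k\ge1$ an integer and $k>\lambda$, $$Z^\lambda=\Big\{f\in C^0:\ \sup_{t>0}\frac{\Omega^k_\varphi(f,t)}{t^\lambda}<\infty\Big\},\qquad \|f\|_{Z^\lambda}=\|f\|_\infty+\sup_{t>0}\frac{\Omega^k_\varphi(f,t)}{t^\lambda}.$$ *)

theory Defs
  imports "HOL-Analysis.Analysis"
begin

text \<open>
  An element of \<open>C\<^sup>0([-1,1])\<close> is represented by a function on all of \<open>\<real>\<close> of which only the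
  values on \<open>[-1,1]\<close> matter. Equality in \<open>C\<^sup>0\<close> is thus pointwise equality on \<open>[-1,1]\<close>.
\<close>

definition C0 :: "(real \<Rightarrow> real) set" where
  "C0 = {f. continuous_on {-1..1} f}"

text \<open>
  Suprema that may be infinite are taken in \<open>ennreal\<close>. There the supremum of the empty set is
  \<open>0\<close>, so that values of \<open>\<tau>\<close> for which \<open>main_part k \<tau>\<close> is empty do not contribute to
  \<open>zyg_modulus\<close>. For \<open>f\<close> in \<open>C0\<close> the suprema over \<open>[-1,1]\<close> and over \<open>main_part k \<tau>\<close> (when
  nonempty) are maxima.
\<close>

definition sup_norm :: "(real \<Rightarrow> real) \<Rightarrow> ennreal" where
  "sup_norm f = (SUP x\<in>{-1..1}. ennreal \<bar>f x\<bar>)"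

definition phi :: "real \<Rightarrow> real" where
  "phi x = sqrt (1 - x\<^sup>2)"

definition phi_diff :: "nat \<Rightarrow> real \<Rightarrow> (real \<Rightarrow> real) \<Rightarrow> real \<Rightarrow> real" where
  "phi_diff k \<tau> f x =
     (\<Sum>i=0..k. (-1) ^ i * real (k choose i) * f (x + \<tau> * phi x / 2 * (real k - 2 * real i)))"

definition main_part :: "nat \<Rightarrow> real \<Rightarrow> real set" where
  "main_part k \<tau> = {-1 + (2 * real k * \<tau>)\<^sup>2 .. 1 - (2 * real k * \<tau>)\<^sup>2}"

definition zyg_modulus :: "nat \<Rightarrow> (real \<Rightarrow> real) \<Rightarrow> real \<Rightarrow> ennreal" where
  "zyg_modulus k f t = (SUP \<tau>\<in>{0<..t}. SUP x\<in>main_part k \<tau>. ennreal \<bar>phi_diff k \<tau> f x\<bar>)"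

definition zyg_seminorm :: "nat \<Rightarrow> real \<Rightarrow> (real \<Rightarrow> real) \<Rightarrow> ennreal" where
  "zyg_seminorm k lam f = (SUP t\<in>{0<..}. zyg_modulus k f t / ennreal (t powr lam))"

text \<open>
  The order \<open>k\<close> of the differences is kept as an explicit parameter; the definitions are meant
  to be used for \<open>0 < lam < k\<close> only.
\<close>

definition zyg_norm :: "nat \<Rightarrow> real \<Rightarrow> (real \<Rightarrow> real) \<Rightarrow> ennreal" where
  "zyg_norm k lam f = sup_norm f + zyg_seminorm k lam f"

definition zygmund :: "nat \<Rightarrow> real \<Rightarrow> (real \<Rightarrow> real) set" where
  "zygmund k lam = {f \<in> C0. zyg_seminorm k lam f < \<infinity>}"

definition K1_op :: "(real \<Rightarrow> real \<Rightarrow> real) \<Rightarrow> (real \<Rightarrow> real) \<Rightarrow> real \<Rightarrow> real" where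
  "K1_op k1 f y = (LBINT x:{-1..1}. k1 x y * f x)"

definition H_op :: "(real \<Rightarrow> real \<Rightarrow> real) \<Rightarrow> (real \<Rightarrow> real) \<Rightarrow> real \<Rightarrow> real" where
  "H_op h f x = h x (f x)"

text \<open>
  At the single point \<open>x = y\<close> the kernels below take the conventional values \<open>0 powr \<mu> = 0\<close> and
  \<open>ln 0 = 0\<close>; this does not affect the integrals.
\<close>

definition Ktilde_op :: "(real \<Rightarrow> real) \<Rightarrow> real \<Rightarrow> (real \<Rightarrow> real) \<Rightarrow> real \<Rightarrow> real" where
  "Ktilde_op \<psi> \<mu> f y =
     (if \<mu> = 0 then LBINT x:{-1..1}. \<psi> x * ln \<bar>x - y\<bar> * f x
      else LBINT x:{-1..1}. \<psi> x * \<bar>x - y\<bar> powr \<mu> * f x)"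

definition K_op ::
  "(real \<Rightarrow> real \<Rightarrow> real) \<Rightarrow> (real \<Rightarrow> real) \<Rightarrow> real \<Rightarrow> (real \<Rightarrow> real \<Rightarrow> real) \<Rightarrow>
     (real \<Rightarrow> real) \<Rightarrow> real \<Rightarrow> real" where
  "K_op k1 \<psi> \<mu> h f y = K1_op k1 f y + Ktilde_op \<psi> \<mu> (H_op h f) y"

text \<open>\<open>f\<close> solves \<open>(I - K) f = g\<close> in \<open>C\<^sup>0\<close>.\<close>

definition solves_eq :: "((real \<Rightarrow> real) \<Rightarrow> real \<Rightarrow> real) \<Rightarrow> (real \<Rightarrow> real) \<Rightarrow> (real \<Rightarrow> real) \<Rightarrow> bool" where
  "solves_eq K g f \<longleftrightarrow> f \<in> C0 \<and> (\<forall>y\<in>{-1..1}. f y - K f y = g y)"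

end

theory Submission
  imports Defs
begin

text \<open>
  The weighted difference of \<open>f\<close> at \<open>x\<close> with parameter \<open>\<tau>\<close> is an ordinary difference with step
  \<open>h = \<tau> \<phi>(x)\<close>, and \<open>\<phi>(x)\<close> is comparable with \<open>\<surd>d\<close>, where \<open>d = 1 - \<bar>x\<bar>\<close> is the distance of \<open>x\<close>
  to the endpoints. Membership of a continuous \<open>f\<close> in \<open>Z\<^sup>s\<close>, measured with differences of order \<open>k\<close>,
  therefore means that \<open>\<bar>\<Delta>\<^sup>k\<^sub>h f(x)\<bar> \<le> C (h / \<surd>d)\<^sup>s\<close> for all \<open>h \<le> c d\<close>, where \<open>c > 0\<close> may be as small
  as one likes (\<open>interior_smooth\<close>): a difference with step \<open>2 h\<close> is a combination of differences with
  step \<open>h\<close>, so a small \<open>c\<close> already reaches all the steps that the definition of \<open>Z\<^sup>s\<close> uses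
  (\<open>interior_smooth_if_zygmund\<close>, \<open>zygmund_if_interior_smooth\<close>). The change of order
  and the singular operator are treated in this form, with ordinary forward differences.

  The hypothesis on \<open>k\<^sub>1\<close> is about differences of order \<open>k\<close> and the conclusion about differences of
  order \<open>m\<close>, so the order has to be changed (\<open>zygmund_change_order\<close>). Raising it is immediate.
  Lowering it from \<open>k + 1\<close> to \<open>k > s\<close> is an inequality of Marchaud type
  (\<open>interior_smooth_lower\<close>): up to differences of order \<open>k + 1\<close>, the difference \<open>\<Delta>\<^sup>k\<^sub>h\<close> is \<open>2\<^sup>-\<^sup>k \<Delta>\<^sup>k\<^sub>2\<^sub>h\<close>,
  while the weight \<open>(h / \<surd>d)\<^sup>s\<close> grows by the factor \<open>2\<^sup>s < 2\<^sup>k\<close> when \<open>h\<close> is doubled, so that the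
  errors sum up like a geometric series. Doubling alone would stop at \<open>h \<approx> d\<close> with a \<open>k\<close>-th difference for which
  boundedness of \<open>f\<close> is too weak an estimate near the endpoints. At that stage the base point is
  moved towards the centre until \<open>d\<close> has doubled, which costs a bounded number of differences of
  order \<open>k + 1\<close>, and the doubling goes on until \<open>h\<close> is of the order of \<open>1\<close>.

  For \<open>K\<^sup>1 f\<close> the difference in \<open>y\<close> passes under the integral, and the hypothesis on \<open>k\<^sub>1\<close> applies
  uniformly in \<open>x\<close> (\<open>K1_op_in_zygmund\<close>). For the singular part let \<open>p(u)\<close> be \<open>\<bar>u\<bar>\<^sup>\<mu>\<close> or \<open>ln \<bar>u\<bar>\<close> and let
  \<open>F = \<psi> \<cdot> H f\<close>, a bounded function. The \<open>m\<close>-th difference of \<open>\<integral> F(x) p(x - y) dx\<close> in \<open>y\<close> is at most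
  \<open>\<parallel>F\<parallel> \<integral> \<bar>\<Delta>\<^sup>m\<^sub>h p(u)\<bar> du\<close>. The derivatives of \<open>p\<close> satisfy \<open>\<bar>p\<^sup>(\<^sup>j\<^sup>)(v)\<bar> \<le> A\<^sub>j v\<^sup>s\<^sup>-\<^sup>1\<^sup>-\<^sup>j\<close> on \<open>(0,4]\<close>
  (\<open>weakly_singular\<close>), so the integral is bounded, near the singularity, by a multiple of
  \<open>\<integral> v\<^sup>s\<^sup>-\<^sup>1 dv\<close> over \<open>0 < v < 2 m h\<close> and, away from it, by a multiple of \<open>h\<^sup>m \<integral> v\<^sup>s\<^sup>-\<^sup>1\<^sup>-\<^sup>m dv\<close> over
  \<open>v > m h\<close>. Since \<open>0 < s < m\<close>, both are multiples of \<open>h\<^sup>s\<close> (\<open>abs_fdiff_convolve_le\<close>), which is more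
  than the interior estimate asks for because \<open>\<surd>d \<le> 1\<close>. For the logarithm the bound with \<open>j = 0\<close>
  holds only for \<open>s < 1\<close>; this is the origin of \<open>\<epsilon>\<close>.

  Finally, the solution is \<open>f\<^sup>* = \<K> f\<^sup>* + g\<close>, a sum of two elements of \<open>Z\<^sup>s\<close>.
\<close>

section \<open>Forward differences\<close>

text \<open>
  Forward rather than central differences: their translates by multiples of the step \<open>h\<close> telescope
  into differences of the next order with the same step, whereas central differences would bring in
  half steps.
\<close>

primrec fdiff :: "nat \<Rightarrow> real \<Rightarrow> (real \<Rightarrow> real) \<Rightarrow> real \<Rightarrow> real" where
  "fdiff 0 h f = f"
| "fdiff (Suc k) h f = (\<lambda>x. fdiff k h f (x + h) - fdiff k h f x)"

lemma fdiff_shift: "fdiff k h (\<lambda>y. f (y + a)) x = fdiff k h f (x + a)"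
  by (induction k arbitrary: x) (simp_all add: add_ac)

lemma fdiff_minus: "fdiff k h (\<lambda>y. f y - g y) x = fdiff k h f x - fdiff k h g x"
  by (induction k arbitrary: x) simp_all

lemma fdiff_Suc_inner: "fdiff (Suc k) h f x = fdiff k h (\<lambda>y. f (y + h) - f y) x"
  by (simp add: fdiff_minus fdiff_shift)

lemma fdiff_eq_sum:
  "fdiff k h f x = (\<Sum>i\<le>k. (-1) ^ i * real (k choose i) * f (x + (real k - real i) * h))"
proof (induction k arbitrary: x)
  case (Suc k)
  have "(\<Sum>i\<le>Suc k. (-1) ^ i * real (Suc k choose i) * f (x + (real (Suc k) - real i) * h))
    = f (x + real (Suc k) * h)
      + (\<Sum>i\<le>k. (-1) ^ Suc i * real (Suc k choose Suc i) * f (x + (real k - real i) * h))"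
    by (subst sum.atMost_Suc_shift) simp
  also have "\<dots> = (f (x + real (Suc k) * h)
      + (\<Sum>i\<le>k. (-1) ^ Suc i * real (k choose Suc i) * f (x + (real k - real i) * h)))
      - (\<Sum>i\<le>k. (-1) ^ i * real (k choose i) * f (x + (real k - real i) * h))"
    by (simp add: sum_subtractf[symmetric] algebra_simps flip: sum.distrib)
  also have "f (x + real (Suc k) * h)
      + (\<Sum>i\<le>k. (-1) ^ Suc i * real (k choose Suc i) * f (x + (real k - real i) * h))
    = (\<Sum>i\<le>Suc k. (-1) ^ i * real (k choose i) * f (x + (real (Suc k) - real i) * h))"
    by (subst sum.atMost_Suc_shift) simp
  also have "\<dots> = (\<Sum>i\<le>k. (-1) ^ i * real (k choose i) * f (x + h + (real k - real i) * h))"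
    by (simp add: algebra_simps)
  finally show ?case by (simp add: Suc)
qed simp

lemma abs_fdiff_le_sum:
  "\<bar>fdiff k h f x\<bar> \<le> (\<Sum>i\<le>k. real (k choose i) * \<bar>f (x + (real k - real i) * h)\<bar>)"
  unfolding fdiff_eq_sum by (rule order_trans[OF sum_abs]) (simp add: abs_mult)

lemma phi_diff_eq_fdiff:
  "phi_diff k \<tau> f x = fdiff k (\<tau> * phi x) f (x - real k * (\<tau> * phi x) / 2)"
  unfolding phi_diff_def fdiff_eq_sum atMost_atLeast0
  by (intro sum.cong refl arg_cong2[where f="(*)"] arg_cong[where f=f]) (simp add: field_simps)

lemma abs_fdiff_le:
  assumes "0 \<le> h" and "\<And>y. x \<le> y \<Longrightarrow> y \<le> x + real k * h \<Longrightarrow> \<bar>f y\<bar> \<le> B"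
  shows "\<bar>fdiff k h f x\<bar> \<le> 2 ^ k * B"
  using assms(2)
proof (induction k arbitrary: x)
  case (Suc k)
  have "\<bar>fdiff k h f (x + h)\<bar> \<le> 2 ^ k * B"
    using Suc.prems \<open>0 \<le> h\<close> by (intro Suc.IH) (auto simp: algebra_simps)
  moreover have "\<bar>fdiff k h f x\<bar> \<le> 2 ^ k * B"
    using Suc.prems \<open>0 \<le> h\<close> by (intro Suc.IH) (auto simp: algebra_simps)
  ultimately show ?case by (simp add: algebra_simps) 
qed (simp)

text \<open>
  Moving the base point by multiples of the step costs only differences of the next order. This is
  how the base point is moved away from the endpoints in \<open>interior_smooth_lower\<close>.
\<close>

lemma fdiff_telescope:
  "fdiff k h f (y + real N * h) - fdiff k h f y = (\<Sum>i<N. fdiff (Suc k) h f (y + real i * h))"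
  by (induction N) (simp_all add: algebra_simps)

text \<open>
  One forward difference with step \<open>2 h\<close> is the sum of two adjacent ones with step \<open>h\<close>. Applying
  this to each of the \<open>k\<close> nested differences writes the left side as a sum of \<open>2\<^sup>k\<close> terms of step \<open>h\<close>.
\<close>

lemma abs_fdiff_double_le:
  assumes "0 \<le> h" and "\<And>y. x \<le> y \<Longrightarrow> y \<le> x + real k * h \<Longrightarrow> \<bar>fdiff k h f y\<bar> \<le> M"
  shows "\<bar>fdiff k (2 * h) f x\<bar> \<le> 2 ^ k * M"
  using assms(2)
proof (induction k arbitrary: x f M)
  case (Suc k)
  define g where "g = (\<lambda>y. f (y + 2 * h) - f y)"
  have g: "fdiff k h g y = fdiff (Suc k) h f (y + h) + fdiff (Suc k) h f y" for y
    unfolding g_def by (simp add: fdiff_minus fdiff_shift algebra_simps)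
  have "\<bar>fdiff k h g y\<bar> \<le> 2 * M" if "x \<le> y" "y \<le> x + real k * h" for y
  proof -
    have "\<bar>fdiff (Suc k) h f (y + h)\<bar> \<le> M" "\<bar>fdiff (Suc k) h f y\<bar> \<le> M"
      using that \<open>0 \<le> h\<close> by (auto intro!: Suc.prems simp del: fdiff.simps simp: algebra_simps)
    then show ?thesis unfolding g by linarith
  qed
  then have "\<bar>fdiff k (2 * h) g x\<bar> \<le> 2 ^ k * (2 * M)" by (rule Suc.IH)
  then show ?case
    by (simp add: fdiff_Suc_inner g_def del: fdiff.simps) 
qed simp

text \<open>
  The \<open>2\<^sup>k\<close> terms just mentioned are differences of the same order at base points that are multiples of
  \<open>h\<close> apart, so replacing them all by the one at \<open>x\<close> produces only differences of order \<open>k + 1\<close>.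
\<close>

lemma abs_fdiff_double_minus_le:
  assumes "0 \<le> h" and "\<And>y. x \<le> y \<Longrightarrow> y \<le> x + real k * h \<Longrightarrow> \<bar>fdiff (Suc k) h f y\<bar> \<le> M"
  shows "\<bar>fdiff k (2 * h) f x - 2 ^ k * fdiff k h f x\<bar> \<le> real k * 2 ^ k * M"
  using assms(2)
proof (induction k arbitrary: x f M)
  case (Suc k)
  define g where "g = (\<lambda>y. f (y + 2 * h) - f y)"
  have g: "fdiff j h g y = fdiff (Suc j) h f (y + h) + fdiff (Suc j) h f y" for j y
    unfolding g_def by (simp add: fdiff_minus fdiff_shift algebra_simps)
  have "\<bar>fdiff (Suc k) h g y\<bar> \<le> 2 * M" if "x \<le> y" "y \<le> x + real k * h" for y
  proof -
    have "\<bar>fdiff (Suc (Suc k)) h f (y + h)\<bar> \<le> M" "\<bar>fdiff (Suc (Suc k)) h f y\<bar> \<le> M"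
      using that \<open>0 \<le> h\<close> by (auto intro!: Suc.prems simp del: fdiff.simps simp: algebra_simps)
    then show ?thesis unfolding g by linarith
  qed
  then have 1: "\<bar>fdiff k (2 * h) g x - 2 ^ k * fdiff k h g x\<bar> \<le> real k * 2 ^ k * (2 * M)"
    by (rule Suc.IH)
  have 2: "fdiff k (2 * h) g x = fdiff (Suc k) (2 * h) f x"
    by (simp add: fdiff_Suc_inner g_def del: fdiff.simps)
  have 3: "2 ^ k * fdiff k h g x - 2 ^ Suc k * fdiff (Suc k) h f x
      = 2 ^ k * fdiff (Suc (Suc k)) h f x"
    unfolding g fdiff.simps(2)[of "Suc k"] by (simp add: algebra_simps del: fdiff.simps)
  have M: "\<bar>fdiff (Suc (Suc k)) h f x\<bar> \<le> M"
    using \<open>0 \<le> h\<close> by (intro Suc.prems) auto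
  then have 4: "\<bar>2 ^ k * fdiff (Suc (Suc k)) h f x\<bar> \<le> 2 ^ k * M"
    by (simp add: abs_mult)
  have "0 \<le> M" using M by linarith
  then have "0 \<le> 2 ^ k * M" by simp
  then have 5: "real k * 2 ^ k * (2 * M) + 2 ^ k * M \<le> real (Suc k) * 2 ^ Suc k * M"
    by (simp add: algebra_simps)
  show ?case using 1 2 3 4 5 by linarith
qed simp

lemma abs_fdiff_dyadic_le:
  assumes "0 \<le> h" and "\<And>y. x \<le> y \<Longrightarrow> y \<le> x + real k * (2 ^ n * h) \<Longrightarrow> \<bar>fdiff k h f y\<bar> \<le> M"
  shows "\<bar>fdiff k (2 ^ n * h) f x\<bar> \<le> (2 ^ k) ^ n * M"
  using assms(2)
proof (induction n arbitrary: x)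
  case (Suc n)
  have "\<bar>fdiff k (2 * (2 ^ n * h)) f x\<bar> \<le> 2 ^ k * ((2 ^ k) ^ n * M)"
  proof (rule abs_fdiff_double_le)
    fix y assume y: "x \<le> y" "y \<le> x + real k * (2 ^ n * h)"
    show "\<bar>fdiff k (2 ^ n * h) f y\<bar> \<le> (2 ^ k) ^ n * M"
      using y by (intro Suc.IH Suc.prems) (auto simp: algebra_simps)
  qed (use \<open>0 \<le> h\<close> in simp)
  then show ?case by (simp add: mult.assoc)
next
  case 0
  show ?case using 0[of x] \<open>0 \<le> h\<close> by simp
qed

text \<open>
  By the mean value theorem, each nested difference trades a factor \<open>h\<close> for one derivative. The
  sequence \<open>D\<close> lists the successive derivatives on the positive half-line.
\<close>

lemma abs_fdiff_le_deriv:
  assumes "\<And>j x. 0 < x \<Longrightarrow> (D j has_real_derivative D (Suc j) x) (at x)"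
    and "\<And>\<xi>. u \<le> \<xi> \<Longrightarrow> \<xi> \<le> u + real m * h \<Longrightarrow> \<bar>D m \<xi>\<bar> \<le> M"
    and "0 < u" "0 < h"
  shows "\<bar>fdiff m h (D 0) u\<bar> \<le> h ^ m * M"
  using assms(1,2)
proof (induction m arbitrary: D M)
  case 0
  show ?case using "0.prems"(2)[of u] by simp
next
  case (Suc m)
  note prems = Suc.prems
  define E where "E = (\<lambda>j y. D j (y + h) - D j y)"
  have "\<bar>fdiff m h (E 0) u\<bar> \<le> h ^ m * (h * M)"
  proof (rule Suc.IH)
    fix j and x :: real assume "0 < x"
    then show "(E j has_real_derivative E (Suc j) x) (at x)"
      unfolding E_def using \<open>0 < h\<close> prems(1)[of x j] prems(1)[of "x + h" j]
      by (intro DERIV_diff) (auto simp: DERIV_shift)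
  next
    fix \<xi> assume \<xi>: "u \<le> \<xi>" "\<xi> \<le> u + real m * h"
    obtain z where z: "\<xi> < z" "z < \<xi> + h" "D m (\<xi> + h) - D m \<xi> = (\<xi> + h - \<xi>) * D (Suc m) z"
      using MVT2[of \<xi> "\<xi> + h" "D m" "D (Suc m)"] \<open>0 < h\<close> \<open>0 < u\<close> \<xi> prems(1) by force
    have "\<bar>D (Suc m) z\<bar> \<le> M" using z(1,2) \<xi> \<open>0 < h\<close> by (intro prems(2)) (auto simp: algebra_simps)
    then show "\<bar>E m \<xi>\<bar> \<le> h * M" using z(3) \<open>0 < h\<close> by (simp add: E_def abs_mult)
  qed
  then show ?case unfolding fdiff_Suc_inner by (simp add: E_def mult.assoc mult.left_commute)
qed

text \<open>
  Reflection turns the points \<open>u, u + h, \<dots>, u + m h\<close> into \<open>- u - m h, \<dots>, - u\<close>. It lets the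
  estimates for kernels be proved to the right of the singularity only.
\<close>

lemma abs_fdiff_even:
  assumes "\<And>u. p (- u) = p u"
  shows "\<bar>fdiff m h p (- u - real m * h)\<bar> = \<bar>fdiff m h p u\<bar>"
proof -
  have "fdiff m h p (- u - real m * h) = (-1) ^ m * fdiff m h p u"
  proof (induction m arbitrary: u)
    case (Suc m)
    have 1: "- u - real (Suc m) * h + h = - u - real m * h"
      and 2: "- u - real (Suc m) * h = - (u + h) - real m * h" by (simp_all add: algebra_simps)
    have "fdiff (Suc m) h p (- u - real (Suc m) * h)
      = fdiff m h p (- u - real m * h) - fdiff m h p (- (u + h) - real m * h)"
      unfolding fdiff.simps(2) 1 unfolding 2 ..
    also have "\<dots> = (-1) ^ m * fdiff m h p u - (-1) ^ m * fdiff m h p (u + h)"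
      by (simp only: Suc.IH)
    finally show ?case by (simp add: algebra_simps)
  qed (simp add: assms)
  then show ?thesis by (simp add: abs_mult power_abs)
qed

section \<open>Interior form of the Zygmund condition\<close>

text \<open>
  The condition \<open>h \<le> c (1 - \<bar>x\<bar>)\<close> with \<open>h > 0\<close> confines \<open>x\<close> to the open interval, and for small \<open>c\<close> all
  the points at which \<open>f\<close> is evaluated have distances to the endpoints comparable with \<open>1 - \<bar>x\<bar>\<close>.
  Leaving \<open>c\<close> unspecified makes the condition easy to transfer between orders.
\<close>

definition interior_smooth :: "nat \<Rightarrow> real \<Rightarrow> (real \<Rightarrow> real) \<Rightarrow> bool" where
  "interior_smooth k s f \<longleftrightarrow> (\<exists>c>0. \<exists>C. \<forall>x h. 0 < h \<longrightarrow> h \<le> c * (1 - \<bar>x\<bar>) \<longrightarrow>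
     \<bar>fdiff k h f x\<bar> \<le> C * (h / sqrt (1 - \<bar>x\<bar>)) powr s)"

text \<open>
  Controls the weight \<open>(h / \<surd>d)\<^sup>s\<close> when the base point, and with it the distance \<open>d\<close>, is changed from \<open>p\<close>
  to \<open>q\<close>. It is used with \<open>a = 2\<close> for nearby points, and with \<open>a = 1\<close> for points further inside.
\<close>

lemma weight_le:
  fixes s :: real
  assumes "0 \<le> s" "0 < h" "0 < a" "0 < p" "p \<le> a\<^sup>2 * q"
  shows "(h / sqrt q) powr s \<le> a powr s * (h / sqrt p) powr s"
proof -
  have q: "0 < q" using assms by (smt (verit) zero_less_mult_pos zero_less_power)
  have "sqrt p \<le> a * sqrt q"
    using assms by (metis real_sqrt_le_iff real_sqrt_mult real_sqrt_abs abs_of_pos)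
  then have "h / sqrt q \<le> a * (h / sqrt p)" using assms q by (simp add: field_simps)
  then have "(h / sqrt q) powr s \<le> (a * (h / sqrt p)) powr s"
    using assms q by (intro powr_mono2) auto
  also have "\<dots> = a powr s * (h / sqrt p) powr s"
    by (rule powr_mult)
  finally show ?thesis .
qed

lemma pos_of_le_mult:
  fixes h c d :: real
  assumes "0 < h" "h \<le> c * d" "0 < c"
  shows "0 < d"
  using assms by (metis less_le_trans zero_less_mult_pos)

lemma interior_smoothI:
  assumes "0 < c" and "\<And>x h. 0 < h \<Longrightarrow> h \<le> c * (1 - \<bar>x\<bar>) \<Longrightarrow>
     \<bar>fdiff k h f x\<bar> \<le> C * (h / sqrt (1 - \<bar>x\<bar>)) powr s"
  shows "interior_smooth k s f"
  using assms unfolding interior_smooth_def by blast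

lemma interior_smoothE:
  assumes "interior_smooth k s f"
  obtains c C where "0 < c" "c \<le> 1" "0 \<le> C"
    "\<And>x h. 0 < h \<Longrightarrow> h \<le> c * (1 - \<bar>x\<bar>) \<Longrightarrow> \<bar>fdiff k h f x\<bar> \<le> C * (h / sqrt (1 - \<bar>x\<bar>)) powr s"
proof -
  obtain c C where c: "0 < c" and
    C: "\<And>x h. 0 < h \<Longrightarrow> h \<le> c * (1 - \<bar>x\<bar>) \<Longrightarrow> \<bar>fdiff k h f x\<bar> \<le> C * (h / sqrt (1 - \<bar>x\<bar>)) powr s"
    using assms unfolding interior_smooth_def by blast
  show ?thesis
  proof (rule that[of "min c 1" "max C 0"])
    fix x h :: real assume h: "0 < h" "h \<le> min c 1 * (1 - \<bar>x\<bar>)"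
    have d: "0 < 1 - \<bar>x\<bar>" by (rule pos_of_le_mult[OF h]) (use c in simp)
    have "min c 1 * (1 - \<bar>x\<bar>) \<le> c * (1 - \<bar>x\<bar>)" using d by (intro mult_right_mono) auto
    then have "\<bar>fdiff k h f x\<bar> \<le> C * (h / sqrt (1 - \<bar>x\<bar>)) powr s" using C h by force
    also have "\<dots> \<le> max C 0 * (h / sqrt (1 - \<bar>x\<bar>)) powr s" by (intro mult_right_mono) auto
    finally show "\<bar>fdiff k h f x\<bar> \<le> max C 0 * (h / sqrt (1 - \<bar>x\<bar>)) powr s" .
  qed (use c in auto)
qed

lemma interior_smooth_Suc:
  assumes "interior_smooth k s f" "0 \<le> s"
  shows "interior_smooth (Suc k) s f"
proof -
  obtain c C where c: "0 < c" "c \<le> 1" and "0 \<le> C" and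
    C: "\<And>x h. 0 < h \<Longrightarrow> h \<le> c * (1 - \<bar>x\<bar>) \<Longrightarrow> \<bar>fdiff k h f x\<bar> \<le> C * (h / sqrt (1 - \<bar>x\<bar>)) powr s"
    using assms(1) by (rule interior_smoothE) blast
  show ?thesis
  proof (rule interior_smoothI[where c="c / 2" and C="C * 2 powr s + C"])
    fix x h :: real assume h: "0 < h" "h \<le> c / 2 * (1 - \<bar>x\<bar>)"
    have d: "0 < 1 - \<bar>x\<bar>" by (rule pos_of_le_mult[OF h]) (use c in simp)
    have "c * (1 - \<bar>x\<bar>) \<le> 1 * (1 - \<bar>x\<bar>)" using c d by (intro mult_right_mono) auto
    then have "2 * h \<le> 1 - \<bar>x\<bar>" using h(2) by simp
    then have d': "1 - \<bar>x\<bar> \<le> 2 * (1 - \<bar>x + h\<bar>)" using h(1) by (simp add: abs_if split: if_splits)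
    have "c * (1 - \<bar>x\<bar>) \<le> c * (2 * (1 - \<bar>x + h\<bar>))" using d' c by (intro mult_left_mono) auto
    then have "h \<le> c * (1 - \<bar>x + h\<bar>)" using h(2) by (simp add: algebra_simps)
    then have "\<bar>fdiff k h f (x + h)\<bar> \<le> C * (h / sqrt (1 - \<bar>x + h\<bar>)) powr s"
      using C h by blast
    also have "\<dots> \<le> C * (2 powr s * (h / sqrt (1 - \<bar>x\<bar>)) powr s)"
      using d d' h assms(2) \<open>0 \<le> C\<close> by (intro mult_left_mono weight_le) auto
    finally have 1: "\<bar>fdiff k h f (x + h)\<bar> \<le> C * (2 powr s * (h / sqrt (1 - \<bar>x\<bar>)) powr s)" .
    have "0 < c * (1 - \<bar>x\<bar>)" using c d by simp
    then have "h \<le> c * (1 - \<bar>x\<bar>)" using h by linarith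
    then have "\<bar>fdiff k h f x\<bar> \<le> C * (h / sqrt (1 - \<bar>x\<bar>)) powr s" using C h by blast
    with 1 have "\<bar>fdiff k h f (x + h)\<bar> + \<bar>fdiff k h f x\<bar>
        \<le> (C * 2 powr s + C) * (h / sqrt (1 - \<bar>x\<bar>)) powr s"
      unfolding distrib_right mult.assoc by (rule add_mono)
    then show "\<bar>fdiff (Suc k) h f x\<bar> \<le> (C * 2 powr s + C) * (h / sqrt (1 - \<bar>x\<bar>)) powr s"
      unfolding fdiff.simps(2) by (rule order_trans[OF abs_triangle_ineq4])
  qed (use c in auto)
qed

lemma interior_smooth_raise:
  assumes "k \<le> m" "interior_smooth k s f" "0 \<le> s"
  shows "interior_smooth m s f"
using assms(1)
proof (induction m rule: dec_induct)
  case (step n)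
  show ?case using step.IH assms(3) by (rule interior_smooth_Suc)
qed (fact assms(2))

section \<open>Changing the order of the differences\<close>

text \<open>
  Marchaud's inequality up to the boundary. The induction behind \<open>main\<close> runs towards larger steps: an estimate for
  the step \<open>2 h\<close> gives one for \<open>h\<close>, with the factor \<open>r = 2\<^sup>s / 2\<^sup>k < 1\<close> in front of the constant, which is
  why one constant \<open>M\<close> survives all the steps. It ends at steps \<open>h \<ge> b\<close> of the order of \<open>1\<close>, where boundedness
  of \<open>f\<close> suffices.
\<close>

lemma interior_smooth_lower:
  assumes smooth: "interior_smooth (Suc k) s f"
    and s: "0 < s" "s < real k"
    and bnd: "\<And>x. x \<in> {-1..1} \<Longrightarrow> \<bar>f x\<bar> \<le> B"
  shows "interior_smooth k s f"
proof -
  obtain c C where c: "0 < c" "c \<le> 1" and "0 \<le> C" and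
    C: "\<And>x h. 0 < h \<Longrightarrow> h \<le> c * (1 - \<bar>x\<bar>) \<Longrightarrow>
          \<bar>fdiff (Suc k) h f x\<bar> \<le> C * (h / sqrt (1 - \<bar>x\<bar>)) powr s"
    using smooth by (rule interior_smoothE) blast
  have "0 < k" using s by (cases k) auto
  define w where "w = (\<lambda>x h. (h / sqrt (1 - \<bar>x\<bar>)) powr s)"
  \<comment> \<open>The first bound leaves room for halving the distance to the endpoints, the second keeps the points of a \<open>k\<close>-th difference within half that distance.\<close>
  define c0 where "c0 = min (c / 2) (1 / (2 * real k))"
  have c0: "0 < c0" "2 * c0 \<le> c" "real k * c0 \<le> 1 / 2" "c0 \<le> 1"
  proof -
    show "0 < c0" "2 * c0 \<le> c" "c0 \<le> 1" using c \<open>0 < k\<close> by (auto simp: c0_def)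
    have "real k * c0 \<le> real k * (1 / (2 * real k))"
      by (intro mult_left_mono) (auto simp: c0_def)
    then show "real k * c0 \<le> 1 / 2" using \<open>0 < k\<close> by simp
  qed
  \<comment> \<open>Let \<open>d = 1 - \<bar>x\<bar>\<close>. If \<open>h < b\<close> and \<open>h > c0 * d / 2\<close>, then \<open>d < 1 / 4\<close>, so that moving inwards by at most \<open>3 * d\<close> cannot approach the other endpoint.\<close>
  define b where "b = c0 / 8"
  \<comment> \<open>With \<open>d = 1 - \<bar>x\<bar>\<close>, this many steps \<open>h > c0 * d / 2\<close> cover at least the distance \<open>d\<close>.\<close>
  define N where "N = nat \<lceil>2 / c0\<rceil>"
  define C' where "C' = real N * C + real k * C * 2 powr s"
  define r where "r = 2 powr s / 2 ^ k"
  have r: "0 < r" "r < 1"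
  proof -
    have "2 powr s < 2 powr real k" using s by (intro powr_less_mono) auto
    then show "r < 1" by (simp add: r_def powr_realpow)
  qed (simp add: r_def)
  define M where "M = max (C' / (1 - r)) (2 ^ k * B / b powr s)"
  have "0 \<le> C'" using \<open>0 \<le> C\<close> by (simp add: C'_def)
  then have "0 \<le> M" using r by (simp add: M_def le_max_iff_disj)
  have "C' / (1 - r) \<le> M" by (simp add: M_def)
  then have M: "r * M + C' \<le> M" using r by (simp add: field_simps)
  have "0 < b" using c0 by (simp add: b_def)
  have base: "\<bar>fdiff k h f x\<bar> \<le> M * w x h"
    if h: "b \<le> h" "h \<le> c0 * (1 - \<bar>x\<bar>)" for x h
  proof -
    have d: "0 < 1 - \<bar>x\<bar>" by (rule pos_of_le_mult[of h c0]) (use h c0 \<open>0 < b\<close> in auto)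
    have kh: "real k * h \<le> (1 - \<bar>x\<bar>) / 2"
    proof -
      have "real k * h \<le> real k * (c0 * (1 - \<bar>x\<bar>))" using h by (intro mult_left_mono) auto
      also have "\<dots> = (real k * c0) * (1 - \<bar>x\<bar>)" by simp
      also have "\<dots> \<le> 1 / 2 * (1 - \<bar>x\<bar>)" using c0 d by (intro mult_right_mono) auto
      finally show ?thesis by simp
    qed
    have "\<bar>fdiff k h f x\<bar> \<le> 2 ^ k * B"
    proof (rule abs_fdiff_le)
      fix y assume y: "x \<le> y" "y \<le> x + real k * h"
      then have "y \<in> {-1..1}" using kh d by (simp add: abs_if split: if_splits)
      then show "\<bar>f y\<bar> \<le> B" by (rule bnd)
    qed (use h \<open>0 < b\<close> in simp)
    also have "\<dots> = 2 ^ k * B / b powr s * b powr s" using \<open>0 < b\<close> by simp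
    also have "\<dots> \<le> M * b powr s" by (intro mult_right_mono) (auto simp: M_def)
    also have "\<dots> \<le> M * w x h"
    proof -
      have "h \<le> h / sqrt (1 - \<bar>x\<bar>)" using d h \<open>0 < b\<close> by (simp add: field_simps)
      then show ?thesis unfolding w_def using h \<open>0 < b\<close> \<open>0 \<le> M\<close> s
        by (intro mult_left_mono powr_mono2) auto
    qed
    finally show ?thesis .
  qed
  have halve: "\<bar>fdiff k h f x\<bar> \<le> r * M * w x h + real k * C * 2 powr s * w x h"
    if h: "0 < h" "2 * h \<le> c0 * (1 - \<bar>x\<bar>)"
      and IH: "\<bar>fdiff k (2 * h) f x\<bar> \<le> M * w x (2 * h)" for x h
  proof -
    have d: "0 < 1 - \<bar>x\<bar>" by (rule pos_of_le_mult[of h c0]) (use h c0 in auto)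
    have kh: "real k * h \<le> (1 - \<bar>x\<bar>) / 4"
    proof -
      have "real k * (2 * h) \<le> real k * (c0 * (1 - \<bar>x\<bar>))" using h by (intro mult_left_mono) auto
      also have "\<dots> = (real k * c0) * (1 - \<bar>x\<bar>)" by simp
      also have "\<dots> \<le> 1 / 2 * (1 - \<bar>x\<bar>)" using c0 d by (intro mult_right_mono) auto
      finally show ?thesis by simp
    qed
    have "\<bar>fdiff k (2 * h) f x - 2 ^ k * fdiff k h f x\<bar> \<le> real k * 2 ^ k * (C * (2 powr s * w x h))"
    proof (rule abs_fdiff_double_minus_le)
      fix y assume y: "x \<le> y" "y \<le> x + real k * h"
      have d': "1 - \<bar>x\<bar> \<le> 2 * (1 - \<bar>y\<bar>)" using y kh by (simp add: abs_if split: if_splits)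
      have "c0 * (1 - \<bar>x\<bar>) \<le> c0 * (2 * (1 - \<bar>y\<bar>))" using d' c0 by (intro mult_left_mono) auto
      also have "\<dots> = (2 * c0) * (1 - \<bar>y\<bar>)" by simp
      also have "\<dots> \<le> c * (1 - \<bar>y\<bar>)" using c0 d d' by (intro mult_right_mono) auto
      finally have "h \<le> c * (1 - \<bar>y\<bar>)" using h by linarith
      then have "\<bar>fdiff (Suc k) h f y\<bar> \<le> C * w y h" using C h unfolding w_def by blast
      also have "\<dots> \<le> C * (2 powr s * w x h)"
        unfolding w_def using d d' h s \<open>0 \<le> C\<close> by (intro mult_left_mono weight_le) auto
      finally show "\<bar>fdiff (Suc k) h f y\<bar> \<le> C * (2 powr s * w x h)" .
    qed (use h in simp)
    moreover have "w x (2 * h) = 2 powr s * w x h"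
      unfolding w_def using powr_mult[of 2 "h / sqrt (1 - \<bar>x\<bar>)" s] by simp
    ultimately have "2 ^ k * \<bar>fdiff k h f x\<bar>
        \<le> M * (2 powr s * w x h) + real k * 2 ^ k * (C * (2 powr s * w x h))"
      using IH unfolding abs_mult[symmetric] by (simp add: abs_mult) 
    then show ?thesis by (simp add: r_def field_simps)
  qed
  have main: "\<bar>fdiff k h f x\<bar> \<le> M * w x h"
    if "0 < h" "h \<le> c0 * (1 - \<bar>x\<bar>)" "b \<le> 2 ^ n * h" for n x h
    using that
  proof (induction n arbitrary: x h)
    case 0
    then show ?case by (intro base) auto
  next
    case (Suc n)
    note h = Suc.prems
    have d: "0 < 1 - \<bar>x\<bar>" by (rule pos_of_le_mult[of h c0]) (use h c0 in auto)
    have close: "r * M * w x h + C' * w x h \<le> M * w x h"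
      using mult_right_mono[OF M, of "w x h"] by (simp add: w_def algebra_simps)
    consider "b \<le> h" | "2 * h \<le> c0 * (1 - \<bar>x\<bar>)"
      | "h < b" "c0 * (1 - \<bar>x\<bar>) < 2 * h" by linarith
    then show ?case
    proof cases
      case 1
      then show ?thesis using h by (intro base) auto
    next
      case 2
      have "\<bar>fdiff k (2 * h) f x\<bar> \<le> M * w x (2 * h)"
        using 2 h by (intro Suc.IH) (auto simp: algebra_simps)
      then have "\<bar>fdiff k h f x\<bar> \<le> r * M * w x h + real k * C * 2 powr s * w x h"
        using 2 h by (intro halve) auto
      also have "\<dots> \<le> r * M * w x h + C' * w x h"
        using \<open>0 \<le> C\<close> by (intro add_left_mono mult_right_mono) (auto simp: C'_def w_def)
      finally show ?thesis using close by linarith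
    next
      case 3
      have d4: "1 - \<bar>x\<bar> < 1 / 4"
      proof -
        have "c0 * (1 - \<bar>x\<bar>) < c0 * (1 / 4)" using 3 by (simp add: b_def)
        then show ?thesis using c0 by simp
      qed
      have Nh: "1 - \<bar>x\<bar> \<le> real N * h" "real N * h \<le> 3 * (1 - \<bar>x\<bar>)"
      proof -
        have "2 / c0 \<le> real N" unfolding N_def using c0 by (simp add: real_nat_ceiling_ge)
        moreover have "h > c0 * (1 - \<bar>x\<bar>) / 2" using 3 by simp
        ultimately have "2 / c0 * (c0 * (1 - \<bar>x\<bar>) / 2) \<le> real N * h"
          using c0 d by (intro mult_mono) auto
        then show "1 - \<bar>x\<bar> \<le> real N * h" using c0 by simp
        have "real N \<le> 2 / c0 + 1" unfolding N_def using c0 by (simp add: of_nat_ceiling)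
        then have "real N * h \<le> (2 / c0 + 1) * (c0 * (1 - \<bar>x\<bar>))"
          using h c0 by (intro mult_mono) auto
        also have "\<dots> = (2 + c0) * (1 - \<bar>x\<bar>)" using c0 by (simp add: field_simps)
        also have "\<dots> \<le> 3 * (1 - \<bar>x\<bar>)" using c0 d by (intro mult_right_mono) auto
        finally show "real N * h \<le> 3 * (1 - \<bar>x\<bar>)" .
      qed
      \<comment> \<open>Moving from \<open>x\<close> by \<open>N\<close> steps towards the centre; \<open>z\<close> is the left end of the way, in either direction.\<close>
      have walk: "\<bar>fdiff k h f (z + real N * h) - fdiff k h f z\<bar> \<le> real N * (C * w x h)"
        if z: "z = x \<and> x < 0 \<or> z + real N * h = x \<and> 0 \<le> x" for z
      proof -
        have "\<bar>fdiff (Suc k) h f (z + real i * h)\<bar> \<le> C * w x h" if "i < N" for i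
        proof -
          have i: "0 \<le> real i * h" "real i * h \<le> real N * h" using that h by auto
          have d': "1 - \<bar>x\<bar> \<le> 1 - \<bar>z + real i * h\<bar>" using z i Nh d4 by (auto simp: abs_if split: if_splits)
          have "c0 * (1 - \<bar>x\<bar>) \<le> c * (1 - \<bar>z + real i * h\<bar>)"
            using c0 d d' by (intro mult_mono) auto
          then have "h \<le> c * (1 - \<bar>z + real i * h\<bar>)" using h by linarith
          then have "\<bar>fdiff (Suc k) h f (z + real i * h)\<bar> \<le> C * w (z + real i * h) h"
            using C h unfolding w_def by blast
          also have "\<dots> \<le> C * (1 powr s * w x h)"
            unfolding w_def using d d' h s \<open>0 \<le> C\<close> by (intro mult_left_mono weight_le) auto
          finally show ?thesis by simp
        qed
        then have "(\<Sum>i<N. \<bar>fdiff (Suc k) h f (z + real i * h)\<bar>) \<le> (\<Sum>i<N. C * w x h)"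
          by (intro sum_mono) (auto simp del: fdiff.simps)
        also have "\<dots> = real N * (C * w x h)" by simp
        finally show ?thesis unfolding fdiff_telescope by (rule order_trans[OF sum_abs])
      qed
      obtain x' where x': "\<bar>fdiff k h f x - fdiff k h f x'\<bar> \<le> real N * (C * w x h)"
        and dx': "2 * (1 - \<bar>x\<bar>) \<le> 1 - \<bar>x'\<bar>"
      proof (cases "0 \<le> x")
        case True
        show thesis
        proof (rule that[of "x - real N * h"])
          show "\<bar>fdiff k h f x - fdiff k h f (x - real N * h)\<bar> \<le> real N * (C * w x h)"
            using walk[of "x - real N * h"] True by simp
          show "2 * (1 - \<bar>x\<bar>) \<le> 1 - \<bar>x - real N * h\<bar>" using True Nh d4 by (simp add: abs_if split: if_splits)
        qed
      next
        case False
        show thesis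
        proof (rule that[of "x + real N * h"])
          show "\<bar>fdiff k h f x - fdiff k h f (x + real N * h)\<bar> \<le> real N * (C * w x h)"
            using walk[of x] False by (simp add: abs_minus_commute)
          show "2 * (1 - \<bar>x\<bar>) \<le> 1 - \<bar>x + real N * h\<bar>" using False Nh d4 by (simp add: abs_if split: if_splits)
        qed
      qed
      have "c0 * (2 * (1 - \<bar>x\<bar>)) \<le> c0 * (1 - \<bar>x'\<bar>)" using dx' c0 by (intro mult_left_mono) auto
      then have h': "2 * h \<le> c0 * (1 - \<bar>x'\<bar>)" using h(2) by (simp add: algebra_simps)
      have "\<bar>fdiff k (2 * h) f x'\<bar> \<le> M * w x' (2 * h)"
        using h h' by (intro Suc.IH) (auto simp: algebra_simps)
      then have "\<bar>fdiff k h f x'\<bar> \<le> r * M * w x' h + real k * C * 2 powr s * w x' h"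
        using h h' by (intro halve) auto
      also have "\<dots> = (r * M + real k * C * 2 powr s) * w x' h" by (simp add: algebra_simps)
      also have "\<dots> \<le> (r * M + real k * C * 2 powr s) * (1 powr s * w x h)"
        unfolding w_def using d dx' h s \<open>0 \<le> C\<close> \<open>0 \<le> M\<close> r by (intro mult_left_mono weight_le) auto
      finally have "\<bar>fdiff k h f x'\<bar> \<le> (r * M + real k * C * 2 powr s) * w x h" by simp
      then have "\<bar>fdiff k h f x\<bar> \<le> real N * (C * w x h) + (r * M + real k * C * 2 powr s) * w x h"
        using x' by linarith
      also have "\<dots> = r * M * w x h + C' * w x h" by (simp add: C'_def algebra_simps)
      finally show ?thesis using close by linarith
    qed
  qed
  show ?thesis
  proof (rule interior_smoothI[where c=c0 and C=M])
    fix x h :: real assume h: "0 < h" "h \<le> c0 * (1 - \<bar>x\<bar>)"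
    obtain n where "b / h < 2 ^ n" using real_arch_pow[of 2 "b / h"] by auto
    then have "b \<le> 2 ^ n * h" using h by (simp add: field_simps)
    then show "\<bar>fdiff k h f x\<bar> \<le> M * (h / sqrt (1 - \<bar>x\<bar>)) powr s"
      using main h unfolding w_def by blast
  qed (use c0 in auto)
qed

lemma interior_smooth_any_order:
  assumes "interior_smooth k s f" "0 < s" "s < real m"
    and bnd: "\<And>x. x \<in> {-1..1} \<Longrightarrow> \<bar>f x\<bar> \<le> B"
  shows "interior_smooth m s f"
proof (cases "m \<le> k")
  case True
  then show ?thesis
  proof (induction m rule: inc_induct)
    case (step n)
    have "s < real n" using step.hyps assms(3) by simp
    with step.IH assms(2) show ?case using bnd by (rule interior_smooth_lower)
  qed (fact assms(1))
next
  case False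
  then show ?thesis using interior_smooth_raise[of k m] assms by simp
qed

section \<open>Zygmund spaces in terms of interior differences\<close>

text \<open>
  Since \<open>\<tau> \<le> t\<close> gives \<open>\<tau>\<^sup>\<lambda> \<le> t\<^sup>\<lambda>\<close>, a bound for every single \<open>\<tau>\<close>, compared with \<open>\<tau>\<^sup>\<lambda>\<close>, is as good as the bound
  on the modulus for every \<open>t\<close>.
\<close>

lemma zyg_seminorm_le_iff:
  assumes "0 \<le> C" "0 \<le> lam"
  shows "zyg_seminorm k lam f \<le> ennreal C \<longleftrightarrow>
    (\<forall>\<tau>>0. \<forall>x\<in>main_part k \<tau>. \<bar>phi_diff k \<tau> f x\<bar> \<le> C * \<tau> powr lam)"
proof (intro iffI allI impI ballI)
  fix \<tau> x assume le: "zyg_seminorm k lam f \<le> ennreal C" and \<tau>: "0 < \<tau>" and x: "x \<in> main_part k \<tau>"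
  have "ennreal \<bar>phi_diff k \<tau> f x\<bar> \<le> (SUP x\<in>main_part k \<tau>. ennreal \<bar>phi_diff k \<tau> f x\<bar>)"
    using x by (rule SUP_upper)
  also have "\<dots> \<le> zyg_modulus k f \<tau>"
    unfolding zyg_modulus_def
    by (rule SUP_upper[where f="\<lambda>\<tau>. SUP x\<in>main_part k \<tau>. ennreal \<bar>phi_diff k \<tau> f x\<bar>"]) (use \<tau> in simp)
  also have "\<dots> = ennreal (\<tau> powr lam) * (zyg_modulus k f \<tau> / ennreal (\<tau> powr lam))"
    using \<tau> by (simp add: ennreal_times_divide mult_divide_eq_ennreal mult.commute[of "ennreal _"])
  also have "\<dots> \<le> ennreal (\<tau> powr lam) * zyg_seminorm k lam f"
    unfolding zyg_seminorm_def
    by (intro mult_left_mono SUP_upper[where f="\<lambda>t. zyg_modulus k f t / ennreal (t powr lam)"])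
      (use \<tau> in simp_all)
  also have "\<dots> \<le> ennreal (\<tau> powr lam) * ennreal C" using le by (intro mult_left_mono) auto
  also have "\<dots> = ennreal (C * \<tau> powr lam)" using assms by (simp add: ennreal_mult' mult.commute)
  finally show "\<bar>phi_diff k \<tau> f x\<bar> \<le> C * \<tau> powr lam"
    using assms by (subst (asm) ennreal_le_iff) auto
next
  assume bound: "\<forall>\<tau>>0. \<forall>x\<in>main_part k \<tau>. \<bar>phi_diff k \<tau> f x\<bar> \<le> C * \<tau> powr lam"
  show "zyg_seminorm k lam f \<le> ennreal C" unfolding zyg_seminorm_def
  proof (rule SUP_least)
    fix t :: real assume t: "t \<in> {0<..}"
    have "zyg_modulus k f t \<le> ennreal (C * t powr lam)" unfolding zyg_modulus_def
    proof (intro SUP_least ennreal_leI)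
      fix \<tau> x assume \<tau>: "\<tau> \<in> {0<..t}" and x: "x \<in> main_part k \<tau>"
      then have "\<bar>phi_diff k \<tau> f x\<bar> \<le> C * \<tau> powr lam" using bound by auto
      also have "\<dots> \<le> C * t powr lam"
        using \<tau> assms by (intro mult_left_mono powr_mono2) auto
      finally show "\<bar>phi_diff k \<tau> f x\<bar> \<le> C * t powr lam" .
    qed
    then show "zyg_modulus k f t / ennreal (t powr lam) \<le> ennreal C"
      using t assms by (intro divide_le_posI_ennreal) (auto simp: ennreal_mult'[symmetric] mult.commute)
  qed
qed

lemma zygmund_iff:
  assumes "0 \<le> lam"
  shows "f \<in> zygmund k lam \<longleftrightarrow> f \<in> C0 \<and>
    (\<exists>C\<ge>0. \<forall>\<tau>>0. \<forall>x\<in>main_part k \<tau>. \<bar>phi_diff k \<tau> f x\<bar> \<le> C * \<tau> powr lam)"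
proof -
  have "zyg_seminorm k lam f < \<infinity> \<longleftrightarrow> (\<exists>C\<ge>0. zyg_seminorm k lam f \<le> ennreal C)"
    by (metis ennreal_cases ennreal_less_top infinity_ennreal_def le_less_trans order_refl less_irrefl)
  then show ?thesis using zyg_seminorm_le_iff[OF _ assms] unfolding zygmund_def by auto
qed

lemma phi_sq_bounds:
  assumes "\<bar>x\<bar> \<le> 1"
  shows "1 - \<bar>x\<bar> \<le> (phi x)\<^sup>2" "(phi x)\<^sup>2 \<le> 2 * (1 - \<bar>x\<bar>)" "0 \<le> phi x"
proof -
  have "x\<^sup>2 \<le> 1" using assms by (simp add: abs_square_le_1)
  then have phi: "(phi x)\<^sup>2 = (1 - \<bar>x\<bar>) * (1 + \<bar>x\<bar>)"
    by (simp add: phi_def algebra_simps power2_eq_square)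
  show "1 - \<bar>x\<bar> \<le> (phi x)\<^sup>2" unfolding phi using assms mult_left_mono[of 1 "1 + \<bar>x\<bar>" "1 - \<bar>x\<bar>"] by simp
  show "(phi x)\<^sup>2 \<le> 2 * (1 - \<bar>x\<bar>)" unfolding phi using assms mult_left_mono[of "1 + \<bar>x\<bar>" 2 "1 - \<bar>x\<bar>"] by simp
  show "0 \<le> phi x" using \<open>x\<^sup>2 \<le> 1\<close> by (simp add: phi_def)
qed

text \<open>
  On \<open>I\<^sub>k\<^sub>\<tau>\<close> one has \<open>(2 k \<tau>)\<^sup>2 \<le> d\<close> and \<open>\<phi>\<^sup>2 \<le> 2 d\<close>, hence \<open>k \<tau> \<phi> \<le> d / \<surd>2\<close>, which \<open>3/4\<close> rounds up. The points
  of a central difference are at distance at most half of this from \<open>x\<close>, so they stay well inside.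
\<close>

lemma main_part_step:
  assumes "x \<in> main_part k \<tau>" "0 < \<tau>" "0 < k"
  shows "0 < 1 - \<bar>x\<bar>" "0 < phi x" "\<tau> \<le> 1" "real k * (\<tau> * phi x) \<le> (1 - \<bar>x\<bar>) * 3 / 4"
proof -
  have d: "(2 * real k * \<tau>)\<^sup>2 \<le> 1 - \<bar>x\<bar>" using assms(1) by (auto simp: main_part_def abs_if)
  moreover have "0 < (2 * real k * \<tau>)\<^sup>2" using assms by simp
  ultimately show pos: "0 < 1 - \<bar>x\<bar>" by linarith
  then have phi: "1 - \<bar>x\<bar> \<le> (phi x)\<^sup>2" "(phi x)\<^sup>2 \<le> 2 * (1 - \<bar>x\<bar>)" "0 \<le> phi x"
    using phi_sq_bounds[of x] by auto
  then show "0 < phi x" using pos by (cases "phi x = 0") auto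
  have "(2 * real k * \<tau>)\<^sup>2 \<le> 1" using d by linarith
  then have "2 * real k * \<tau> \<le> 1" using assms by (simp add: abs_square_le_1)
  moreover have "1 * \<tau> \<le> 2 * real k * \<tau>" using assms by (intro mult_right_mono) auto
  ultimately show "\<tau> \<le> 1" by linarith
  have "(real k * (\<tau> * phi x))\<^sup>2 = (2 * real k * \<tau>)\<^sup>2 * (phi x)\<^sup>2 / 4"
    by (simp add: power_mult_distrib)
  also have "\<dots> \<le> (1 - \<bar>x\<bar>) * (2 * (1 - \<bar>x\<bar>)) / 4"
    using d phi pos by (intro divide_right_mono mult_mono) auto
  also have "\<dots> = (1 - \<bar>x\<bar>)\<^sup>2 / 2" by (simp add: power2_eq_square)
  also have "\<dots> \<le> (1 - \<bar>x\<bar>)\<^sup>2 * (3 / 4)\<^sup>2"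
    unfolding divide_inverse by (intro mult_left_mono) (auto simp: power2_eq_square)
  also have "\<dots> = ((1 - \<bar>x\<bar>) * 3 / 4)\<^sup>2" 
    by (simp only: times_divide_eq_right[symmetric] power_mult_distrib)
  finally show "real k * (\<tau> * phi x) \<le> (1 - \<bar>x\<bar>) * 3 / 4"
    by (rule power2_le_imp_le) (use pos in simp)
qed

lemma main_part_points:
  assumes x: "x \<in> main_part k \<tau>" "0 < \<tau>" "0 < k" and "i \<le> k"
  shows "x + \<tau> * phi x / 2 * (real k - 2 * real i) \<in> {-1..1}"
proof -
  note step = main_part_step[OF x]
  have "\<bar>\<tau> * phi x / 2 * (real k - 2 * real i)\<bar> = \<tau> * phi x / 2 * \<bar>real k - 2 * real i\<bar>"
    using step x by (simp add: abs_mult)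
  also have "\<dots> \<le> \<tau> * phi x / 2 * real k"
    using assms step by (intro mult_left_mono) auto
  also have "\<dots> \<le> 1 - \<bar>x\<bar>" using step by (simp add: mult.commute)
  finally show ?thesis by (simp add: abs_if split: if_splits)
qed

text \<open>
  A forward difference based at \<open>y\<close> with step \<open>h\<close> is the central one at \<open>x = y + k h / 2\<close> with
  \<open>\<tau> = h / \<phi>(x)\<close>; the choice \<open>c = 1 / (4 k)\<close> ensures \<open>x \<in> I\<^sub>k\<^sub>\<tau>\<close>.
\<close>

lemma interior_smooth_if_zygmund:
  assumes f: "f \<in> zygmund k lam" and "0 \<le> lam" "0 < k"
  shows "interior_smooth k lam f"
proof -
  obtain C where "0 \<le> C" and
    C: "\<And>\<tau> x. 0 < \<tau> \<Longrightarrow> x \<in> main_part k \<tau> \<Longrightarrow> \<bar>phi_diff k \<tau> f x\<bar> \<le> C * \<tau> powr lam"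
    using f \<open>0 \<le> lam\<close> by (auto simp: zygmund_iff)
  define c where "c = 1 / (4 * real k)"
  show ?thesis
  proof (rule interior_smoothI[where c=c and C="C * 2 powr lam"])
    show "0 < c" using \<open>0 < k\<close> by (simp add: c_def)
    fix y h :: real assume h: "0 < h" "h \<le> c * (1 - \<bar>y\<bar>)"
    have dy: "0 < 1 - \<bar>y\<bar>" using h \<open>0 < c\<close> by (rule pos_of_le_mult)
    have kh: "4 * (real k * h) \<le> 1 - \<bar>y\<bar>" using h(2) \<open>0 < k\<close> by (simp add: c_def field_simps)
    have kh0: "0 < real k * h" using h \<open>0 < k\<close> by simp
    define x where "x = y + real k * h / 2"
    have dx: "1 - \<bar>y\<bar> \<le> 2 * (1 - \<bar>x\<bar>)" 
      using kh kh0 unfolding x_def by (simp add: abs_if split: if_splits)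
    have phi: "1 - \<bar>x\<bar> \<le> (phi x)\<^sup>2" "0 \<le> phi x" using phi_sq_bounds[of x] dx dy by auto
    then have phi0: "0 < phi x" using dx dy by (cases "phi x = 0") auto
    define \<tau> where "\<tau> = h / phi x"
    have \<tau>: "0 < \<tau>" "\<tau> * phi x = h" using h phi0 by (auto simp: \<tau>_def)
    have "(2 * real k * \<tau>)\<^sup>2 = (2 * (real k * h))\<^sup>2 / (phi x)\<^sup>2"
      by (simp add: \<tau>_def power_divide power_mult_distrib)
    also have "\<dots> \<le> (1 - \<bar>x\<bar>)\<^sup>2 / (1 - \<bar>x\<bar>)"
      using phi dx dy kh kh0 by (intro frac_le power_mono) auto
    also have "\<dots> = 1 - \<bar>x\<bar>" using dx dy by (simp add: power2_eq_square)
    finally have "x \<in> main_part k \<tau>" unfolding main_part_def by (simp add: abs_if split: if_splits)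
    then have "\<bar>phi_diff k \<tau> f x\<bar> \<le> C * \<tau> powr lam" using C \<tau> by blast
    moreover have "phi_diff k \<tau> f x = fdiff k h f y"
      unfolding phi_diff_eq_fdiff \<tau> by (simp add: x_def)
    moreover have "C * \<tau> powr lam \<le> C * (2 powr lam * (h / sqrt (1 - \<bar>y\<bar>)) powr lam)"
    proof -
      have "\<tau> = h / sqrt ((phi x)\<^sup>2)" using phi by (simp add: \<tau>_def)
      then show ?thesis using \<open>0 \<le> C\<close> h dy dx phi \<open>0 \<le> lam\<close>
        by (simp only:) (intro mult_left_mono weight_le, auto)
    qed
    ultimately show "\<bar>fdiff k h f y\<bar> \<le> C * 2 powr lam * (h / sqrt (1 - \<bar>y\<bar>)) powr lam"
      by (simp add: mult.assoc)
  qed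
qed

text \<open>
  The steps \<open>\<tau> \<phi>(x)\<close> admitted by \<open>I\<^sub>k\<^sub>\<tau>\<close> may exceed \<open>c (1 - \<bar>x\<bar>)\<close> by a fixed factor. They are therefore divided by a
  fixed power of \<open>2\<close>.
\<close>

lemma zygmund_if_interior_smooth:
  assumes f: "f \<in> C0" "interior_smooth k s f" and "0 \<le> s" "0 < k"
  shows "f \<in> zygmund k s"
proof -
  obtain c C where c: "0 < c" "c \<le> 1" and "0 \<le> C" and
    C: "\<And>x h. 0 < h \<Longrightarrow> h \<le> c * (1 - \<bar>x\<bar>) \<Longrightarrow> \<bar>fdiff k h f x\<bar> \<le> C * (h / sqrt (1 - \<bar>x\<bar>)) powr s"
    using f(2) by (rule interior_smoothE) blast
  obtain n where "2 / c < 2 ^ n" using real_arch_pow[of 2 "2 / c"] by auto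
  then have n: "2 \<le> c * 2 ^ n" using c by (simp add: field_simps)
  define D where "D = (2 ^ k) ^ n * (C * 4 powr s)"
  have "\<bar>phi_diff k \<tau> f x\<bar> \<le> D * \<tau> powr s" if \<tau>: "0 < \<tau>" and x: "x \<in> main_part k \<tau>" for \<tau> x
  proof -
    have d: "0 < 1 - \<bar>x\<bar>" and phi0: "0 < phi x"
      and kh: "real k * (\<tau> * phi x) \<le> (1 - \<bar>x\<bar>) * 3 / 4"
      using main_part_step[OF x \<tau> \<open>0 < k\<close>] by auto
    have phi: "(phi x)\<^sup>2 \<le> 2 * (1 - \<bar>x\<bar>)" using phi_sq_bounds(2)[of x] d by simp
    define h where "h = \<tau> * phi x / 2 ^ n"
    have h: "0 < h" "2 ^ n * h = \<tau> * phi x" using \<tau> phi0 by (auto simp: h_def)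
    have h_le: "\<tau> * phi x \<le> real k * (\<tau> * phi x)" using \<tau> phi0 \<open>0 < k\<close> by simp
    have "\<bar>fdiff k (2 ^ n * h) f (x - real k * (\<tau> * phi x) / 2)\<bar> \<le> (2 ^ k) ^ n * (C * (4 powr s * \<tau> powr s))"
    proof (rule abs_fdiff_dyadic_le)
      fix y assume "x - real k * (\<tau> * phi x) / 2 \<le> y"
        "y \<le> x - real k * (\<tau> * phi x) / 2 + real k * (2 ^ n * h)"
      then have y: "x - (1 - \<bar>x\<bar>) / 2 \<le> y" "y \<le> x + (1 - \<bar>x\<bar>) / 2"
        using kh d unfolding h(2) by (simp_all add: field_simps)
      then have dy: "1 - \<bar>x\<bar> \<le> 2 * (1 - \<bar>y\<bar>)"
        by (auto simp: abs_if field_simps split: if_splits)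
      have "2 * h \<le> c * 2 ^ n * h" using n h by (intro mult_right_mono) auto
      also have "\<dots> = c * (\<tau> * phi x)" using h by (simp add: mult.assoc)
      also have "\<dots> \<le> c * (2 * (1 - \<bar>y\<bar>))" using dy kh h_le c d by (intro mult_left_mono) auto
      finally have "h \<le> c * (1 - \<bar>y\<bar>)" by (simp add: algebra_simps)
      then have "\<bar>fdiff k h f y\<bar> \<le> C * (h / sqrt (1 - \<bar>y\<bar>)) powr s" using C h by blast
      also have "\<dots> \<le> C * (2 powr s * (h / sqrt ((phi x)\<^sup>2)) powr s)"
        using h phi phi0 dy \<open>0 \<le> C\<close> \<open>0 \<le> s\<close> by (intro mult_left_mono weight_le) auto
      also have "\<dots> \<le> C * (4 powr s * \<tau> powr s)"
      proof -
        have "h / sqrt ((phi x)\<^sup>2) \<le> \<tau>" using \<tau> phi0 by (simp add: h_def field_simps)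
        then show ?thesis using h \<tau> \<open>0 \<le> C\<close> \<open>0 \<le> s\<close> phi0
          by (intro mult_left_mono mult_mono powr_mono2) auto
      qed
      finally show "\<bar>fdiff k h f y\<bar> \<le> C * (4 powr s * \<tau> powr s)" .
    qed (use h in simp)
    then show ?thesis unfolding phi_diff_eq_fdiff h(2) by (simp add: D_def mult.assoc)
  qed
  moreover have "0 \<le> D" using \<open>0 \<le> C\<close> by (simp add: D_def)
  ultimately show ?thesis using f(1) \<open>0 \<le> s\<close> by (auto simp: zygmund_iff)
qed

lemma C0_bounded:
  assumes "f \<in> C0"
  obtains B where "0 \<le> B" "\<And>x. x \<in> {-1..1} \<Longrightarrow> \<bar>f x\<bar> \<le> B"
proof -
  have "compact (f ` {-1..1})" using assms by (auto simp: C0_def intro: compact_continuous_image)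
  then obtain B where "\<forall>y\<in>f ` {-1..1}. norm y \<le> B" using compact_imp_bounded bounded_iff by metis
  then show thesis by (intro that[of "max B 0"]) (auto simp: le_max_iff_disj)
qed

text \<open>
  The parameters with nonempty \<open>I\<^sub>k\<^sub>\<tau>\<close> satisfy \<open>\<tau> \<le> 1\<close>, so lowering the exponent weakens the bound.
\<close>

lemma zygmund_mono:
  assumes f: "f \<in> zygmund k lam" and "0 \<le> s" "s \<le> lam" "0 < k"
  shows "f \<in> zygmund k s"
proof -
  obtain C where "0 \<le> C" and
    C: "\<And>\<tau> x. 0 < \<tau> \<Longrightarrow> x \<in> main_part k \<tau> \<Longrightarrow> \<bar>phi_diff k \<tau> f x\<bar> \<le> C * \<tau> powr lam"
    using f assms by (auto simp: zygmund_iff)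
  have "\<bar>phi_diff k \<tau> f x\<bar> \<le> C * \<tau> powr s" if "0 < \<tau>" "x \<in> main_part k \<tau>" for \<tau> x
  proof -
    have "\<tau> \<le> 1" using main_part_step(3)[OF that(2,1) \<open>0 < k\<close>] .
    then have "C * \<tau> powr lam \<le> C * \<tau> powr s"
      using \<open>0 \<le> C\<close> that assms by (intro mult_left_mono powr_mono') auto
    then show ?thesis using C[OF that] by linarith
  qed
  then show ?thesis using f \<open>0 \<le> C\<close> assms by (auto simp: zygmund_iff)
qed

lemma zygmund_change_order:
  assumes f: "f \<in> zygmund k s" and "0 < s" "s < real m" "0 < k"
  shows "f \<in> zygmund m s"
proof -
  have C0: "f \<in> C0" using f by (simp add: zygmund_def)
  then obtain B where B: "\<And>x. x \<in> {-1..1} \<Longrightarrow> \<bar>f x\<bar> \<le> B" using C0_bounded by metis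
  have "interior_smooth k s f" using f less_imp_le[OF \<open>0 < s\<close>] \<open>0 < k\<close>
    by (rule interior_smooth_if_zygmund)
  then have "interior_smooth m s f" using \<open>0 < s\<close> \<open>s < real m\<close> B
    by (rule interior_smooth_any_order)
  moreover have "0 < m" using assms by (cases m) auto
  ultimately show ?thesis using C0 \<open>0 < s\<close> by (simp add: zygmund_if_interior_smooth)
qed

lemma zygmund_add_cong:
  assumes "f \<in> zygmund k s" "g \<in> zygmund k s" "0 \<le> s" "0 < k"
    and eq: "\<And>x. x \<in> {-1..1} \<Longrightarrow> u x = f x + g x"
  shows "u \<in> zygmund k s"
proof -
  obtain C D where "0 \<le> C" "0 \<le> D" and
    C: "\<And>\<tau> x. 0 < \<tau> \<Longrightarrow> x \<in> main_part k \<tau> \<Longrightarrow> \<bar>phi_diff k \<tau> f x\<bar> \<le> C * \<tau> powr s" and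
    D: "\<And>\<tau> x. 0 < \<tau> \<Longrightarrow> x \<in> main_part k \<tau> \<Longrightarrow> \<bar>phi_diff k \<tau> g x\<bar> \<le> D * \<tau> powr s"
    using assms(1-3) by (auto simp: zygmund_iff)
  have "\<bar>phi_diff k \<tau> u x\<bar> \<le> (C + D) * \<tau> powr s" if \<tau>: "0 < \<tau>" and x: "x \<in> main_part k \<tau>" for \<tau> x
  proof -
    have "phi_diff k \<tau> u x = phi_diff k \<tau> f x + phi_diff k \<tau> g x"
      unfolding phi_diff_def sum.distrib[symmetric]
      by (intro sum.cong refl) (subst eq[OF main_part_points[OF x \<tau> \<open>0 < k\<close>]], auto simp: distrib_left)
    then show ?thesis using C[OF \<tau> x] D[OF \<tau> x] by (simp add: distrib_right)
  qed
  moreover have "u \<in> C0"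
  proof -
    have "continuous_on {-1..1} (\<lambda>x. f x + g x)"
      using assms(1,2) by (intro continuous_on_add) (auto simp: zygmund_def C0_def)
    then show ?thesis unfolding C0_def using eq continuous_on_cong[OF refl, of "{-1..1}" u] by auto
  qed
  ultimately show ?thesis using \<open>0 \<le> C\<close> \<open>0 \<le> D\<close> \<open>0 \<le> s\<close>
    by (auto simp: zygmund_iff intro!: exI[of _ "C + D"])
qed

section \<open>Weakly singular kernels\<close>

text \<open>
  Even kernels that are, together with all their derivatives, of the size of \<open>v\<^sup>s\<^sup>-\<^sup>1\<close> and its
  derivatives. The range \<open>v \<le> 4\<close> comfortably contains the distances between points of \<open>[-1,1]\<close>, and
  being bounded it makes the condition weaker for smaller \<open>s\<close>. As \<open>0 powr (s - 1)\<close> is \<open>0\<close>, requiring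
  \<open>p 0 = 0\<close> extends the bound by \<open>\<bar>v\<bar>\<^sup>s\<^sup>-\<^sup>1\<close> to the singular point.
\<close>

definition weakly_singular :: "real \<Rightarrow> (real \<Rightarrow> real) \<Rightarrow> bool" where
  "weakly_singular s p \<longleftrightarrow> p \<in> borel_measurable borel \<and> p 0 = 0 \<and> (\<forall>u. p (- u) = p u) \<and>
     (\<exists>D A. D 0 = p
       \<and> (\<forall>j v. 0 < v \<longrightarrow> (D j has_real_derivative D (Suc j) v) (at v))
       \<and> (\<forall>j v. 0 < v \<longrightarrow> v \<le> 4 \<longrightarrow> \<bar>D j v\<bar> \<le> A j * v powr (s - 1 - real j)))"

lemma abs_powr_deriv:
  fixes a :: real
  assumes "0 < v"
  shows "((\<lambda>v. c * \<bar>v\<bar> powr a) has_real_derivative c * a * \<bar>v\<bar> powr (a - 1)) (at v)"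
proof -
  have "((\<lambda>v. c * v powr a) has_real_derivative c * (a * v powr (a - 1))) (at v)"
    using assms by (intro DERIV_cmult has_real_derivative_powr)
  moreover have "\<forall>\<^sub>F v' in nhds v. c * v' powr a = c * \<bar>v'\<bar> powr a"
    by (rule eventually_mono[OF eventually_nhds_in_open[of "{0<..}" v]]) (use assms in auto)
  ultimately show ?thesis using assms by (subst (asm) DERIV_cong_ev) (auto simp: mult.assoc)
qed

lemma weakly_singular_powr: "weakly_singular (\<mu> + 1) (\<lambda>u. \<bar>u\<bar> powr \<mu>)"
proof -
  define q where "q = (\<lambda>j. \<Prod>i<j. \<mu> - real i)"
  define D where "D = (\<lambda>j v. q j * \<bar>v\<bar> powr (\<mu> - real j))"
  have "(D j has_real_derivative D (Suc j) v) (at v)" if "0 < v" for j v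
    using abs_powr_deriv[OF that, of "q j" "\<mu> - real j"] by (simp add: D_def q_def algebra_simps)
  moreover have "D 0 = (\<lambda>u. \<bar>u\<bar> powr \<mu>)" by (simp add: D_def q_def)
  moreover have "\<bar>D j v\<bar> \<le> \<bar>q j\<bar> * v powr (\<mu> + 1 - 1 - real j)" if "0 < v" for j v
    using that by (simp add: D_def abs_mult)
  ultimately show ?thesis unfolding weakly_singular_def
    by (intro conjI exI[of _ D] exI[of _ "\<lambda>j. \<bar>q j\<bar>"]) auto
qed

text \<open>
  The derivatives of the logarithm have the size \<open>v\<^sup>-\<^sup>j\<close>, which would fit \<open>s = 1\<close>. It is the logarithm itself that
  is not bounded by a constant, but by any negative power near \<open>0\<close>.
\<close>

lemma weakly_singular_ln:
  assumes s: "0 < s" "s < 1"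
  shows "weakly_singular s (\<lambda>u. ln \<bar>u\<bar>)"
proof -
  define q where "q = (\<lambda>j. \<Prod>i<j. - 1 - real i)"
  define D where "D = (\<lambda>j v. case j of 0 \<Rightarrow> ln \<bar>v\<bar> | Suc i \<Rightarrow> q i * \<bar>v\<bar> powr (- 1 - real i))"
  define a where "a = 1 - s"
  have a: "0 < a" using s by (simp add: a_def)
  define A where "A = (\<lambda>j. case j of 0 \<Rightarrow> 1 / a + 3 * 4 powr a | Suc i \<Rightarrow> \<bar>q i\<bar> * 4 powr a)"
  have "(D j has_real_derivative D (Suc j) v) (at v)" if "0 < v" for j v
  proof (cases j)
    case 0
    have "(ln has_real_derivative inverse v) (at v)" using that by (rule DERIV_ln)
    moreover have "\<forall>\<^sub>F v' in nhds v. ln v' = ln \<bar>v'\<bar>"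
      by (rule eventually_mono[OF eventually_nhds_in_open[of "{0<..}" v]]) (use that in auto)
    ultimately have "((\<lambda>v. ln \<bar>v\<bar>) has_real_derivative inverse v) (at v)"
      by (subst (asm) DERIV_cong_ev) auto
    then show ?thesis using that by (simp add: 0 D_def q_def powr_minus)
  next
    case (Suc i)
    then show ?thesis using abs_powr_deriv[OF that, of "q i" "- 1 - real i"]
      by (simp add: D_def q_def algebra_simps)
  qed
  moreover have "D 0 = (\<lambda>u. ln \<bar>u\<bar>)" by (simp add: D_def)
  moreover have "\<bar>D j v\<bar> \<le> A j * v powr (s - 1 - real j)" if v: "0 < v" "v \<le> 4" for j v
  proof (cases j)
    case 0
    have "\<bar>ln v\<bar> \<le> (1 / a + 3 * 4 powr a) * v powr (- a)"
    proof (cases "v \<le> 1")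
      case True
      have "\<bar>ln v\<bar> = ln (1 / v)" using v True by (simp add: ln_div)
      also have "\<dots> \<le> (1 / v) powr a / a" using v True a by (intro ln_powr_bound) auto
      also have "\<dots> = 1 / a * v powr (- a)" using v by (simp add: powr_minus_divide powr_divide)
      also have "\<dots> \<le> (1 / a + 3 * 4 powr a) * v powr (- a)" by (intro mult_right_mono) auto
      finally show ?thesis .
    next
      case False
      have "\<bar>ln v\<bar> \<le> 3" using ln_le_minus_one[of v] v False by simp
      also have "\<dots> = 3 * 4 powr a * 4 powr (- a)" by (simp add: powr_minus)
      also have "\<dots> \<le> 3 * 4 powr a * v powr (- a)"
        using v a by (intro mult_left_mono powr_mono2') auto
      also have "\<dots> \<le> (1 / a + 3 * 4 powr a) * v powr (- a)"
        using a by (intro mult_right_mono) auto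
      finally show ?thesis .
    qed
    then show ?thesis using v by (simp add: 0 D_def A_def a_def)
  next
    case (Suc i)
    have "v powr (- 1 - real i) = v powr a * v powr (s - 1 - real j)"
      using v by (simp add: a_def Suc flip: powr_add)
    also have "\<dots> \<le> 4 powr a * v powr (s - 1 - real j)"
      using v a by (intro mult_right_mono powr_mono2) auto
    finally have "\<bar>q i\<bar> * v powr (- 1 - real i) \<le> \<bar>q i\<bar> * (4 powr a * v powr (s - 1 - real j))"
      by (rule mult_left_mono) simp
    then show ?thesis using v by (simp add: Suc D_def A_def abs_mult)
  qed
  ultimately show ?thesis unfolding weakly_singular_def
    by (intro conjI exI[of _ D] exI[of _ A]) auto
qed

lemma weakly_singular_mono:
  assumes "weakly_singular s p" "s' \<le> s"
  shows "weakly_singular s' p"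
proof -
  obtain D A where D: "D 0 = p" "\<And>j v. 0 < v \<Longrightarrow> (D j has_real_derivative D (Suc j) v) (at v)"
    and A: "\<And>j v. 0 < v \<Longrightarrow> v \<le> 4 \<Longrightarrow> \<bar>D j v\<bar> \<le> A j * v powr (s - 1 - real j)"
    and p: "p \<in> borel_measurable borel" "p 0 = 0" "\<And>u. p (- u) = p u"
    using assms(1) unfolding weakly_singular_def by blast
  have "\<bar>D j v\<bar> \<le> \<bar>A j\<bar> * 4 powr (s - s') * v powr (s' - 1 - real j)" if v: "0 < v" "v \<le> 4" for j v
  proof -
    have "\<bar>D j v\<bar> \<le> \<bar>A j\<bar> * v powr (s - 1 - real j)"
      using A[OF v, of j] mult_right_mono[OF abs_ge_self[of "A j"], of "v powr (s - 1 - real j)"] by simp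
    also have "v powr (s - 1 - real j) = v powr (s - s') * v powr (s' - 1 - real j)"
      by (simp add: algebra_simps flip: powr_add)
    also have "\<dots> \<le> 4 powr (s - s') * v powr (s' - 1 - real j)"
      using v assms(2) by (intro mult_right_mono powr_mono2) auto
    finally show ?thesis by (simp add: mult.assoc mult_left_mono)
  qed
  then show ?thesis unfolding weakly_singular_def using D p
    by (intro conjI exI[of _ D] exI[of _ "\<lambda>j. \<bar>A j\<bar> * 4 powr (s - s')"]) auto
qed

section \<open>Integrals of differences of a weakly singular kernel\<close>

lemma nn_integral_powr_near_0:
  assumes "0 < s" "0 \<le> R"
  shows "(\<integral>\<^sup>+v. ennreal (\<bar>v\<bar> powr (s - 1)) * indicator {-R..R} v \<partial>lborel) \<le> ennreal (2 * (R powr s / s))"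
proof -
  define f where "f = (\<lambda>v::real. ennreal (v powr (s - 1)) * indicator {0..R} v)"
  have [measurable]: "f \<in> borel_measurable borel" unfolding f_def by measurable
  have "((\<lambda>v. v powr (s - 1)) has_integral (R powr s / s)) {0..R}"
    using has_integral_powr_from_0[of "s - 1" R] assms by simp
  then have f: "(\<integral>\<^sup>+v. f v \<partial>lborel) = ennreal (R powr s / s)"
    unfolding f_def by (rule nn_integral_has_integral_lebesgue'[rotated]) simp
  have "(\<integral>\<^sup>+v. ennreal (\<bar>v\<bar> powr (s - 1)) * indicator {-R..R} v \<partial>lborel)
      \<le> (\<integral>\<^sup>+v. f v + f (0 + (-1) * v) \<partial>lborel)"
    by (intro nn_integral_mono) (auto simp: f_def indicator_def)
  also have "\<dots> = (\<integral>\<^sup>+v. f v \<partial>lborel) + (\<integral>\<^sup>+v. f (0 + (-1) * v) \<partial>lborel)"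
    by (intro nn_integral_add) auto
  also have "(\<integral>\<^sup>+v. f (0 + (-1) * v) \<partial>lborel) = (\<integral>\<^sup>+v. f v \<partial>lborel)"
    using nn_integral_real_affine[of f "-1" 0] by simp
  finally show ?thesis using assms by (simp add: f flip: ennreal_plus)
qed

lemma nn_integral_powr_tail:
  fixes e R :: real
  assumes "e < -1" "0 < R"
  shows "(\<integral>\<^sup>+v. ennreal (v powr e) * indicator {R..} v \<partial>lborel) = ennreal (R powr (e + 1) / (- e - 1))"
proof -
  have "((\<lambda>v. v powr e) has_integral (R powr (e + 1) / (- e - 1))) {R..}"
    using has_integral_powr_to_inf[OF assms] by (simp add: minus_divide_right)
  then show ?thesis by (rule nn_integral_has_integral_lebesgue'[rotated]) simp
qed

lemma nn_integral_shift:
  fixes f :: "real \<Rightarrow> ennreal"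
  assumes "f \<in> borel_measurable borel"
  shows "(\<integral>\<^sup>+u. f (u + a) \<partial>lborel) = (\<integral>\<^sup>+u. f u \<partial>lborel)"
    and "(\<integral>\<^sup>+u. f (a - u) \<partial>lborel) = (\<integral>\<^sup>+u. f u \<partial>lborel)"
  using nn_integral_real_affine[OF assms, of 1 a] nn_integral_real_affine[OF assms, of "-1" a]
  by (simp_all add: add.commute)

text \<open>
  A majorant of \<open>\<bar>\<Delta>\<^sup>m\<^sub>h p(u)\<bar>\<close>. The sum covers \<open>- 2 m h < u < m h\<close>, where the points of the difference may lie on both
  sides of the singularity or close to it and each value of \<open>p\<close> is estimated separately. The last
  two terms cover \<open>u \<ge> m h\<close> and the mirror image \<open>u \<le> - 2 m h\<close>, where \<open>p\<close> is smooth between the points and its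
  \<open>m\<close>-th derivative is used.
\<close>

definition fdiff_majorant :: "real \<Rightarrow> real \<Rightarrow> nat \<Rightarrow> real \<Rightarrow> real \<Rightarrow> ennreal" where
  "fdiff_majorant A s m h u =
     (\<Sum>i\<le>m. ennreal (real (m choose i) * A) *
        (ennreal (\<bar>u + (real m - real i) * h\<bar> powr (s - 1))
          * indicator {- (2 * real m * h)..2 * real m * h} (u + (real m - real i) * h)))
     + (ennreal (A * h ^ m) * (ennreal (u powr (s - 1 - real m)) * indicator {real m * h..} u)
      + ennreal (A * h ^ m) * (ennreal ((- (real m * h) - u) powr (s - 1 - real m))
           * indicator {real m * h..} (- (real m * h) - u)))"

lemma measurable_fdiff_majorant [measurable]: "fdiff_majorant A s m h \<in> borel_measurable borel"
  unfolding fdiff_majorant_def by measurable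

text \<open>
  All summands are translates or reflections of two functions. That of type \<open>v\<^sup>s\<^sup>-\<^sup>1\<close> is integrable at \<open>0\<close> as
  \<open>s > 0\<close>, and that of type \<open>v\<^sup>s\<^sup>-\<^sup>1\<^sup>-\<^sup>m\<close> at infinity as \<open>s < m\<close>; by homogeneity each contributes a multiple of
  \<open>h\<^sup>s\<close>.
\<close>

lemma nn_integral_fdiff_majorant:
  assumes "0 < s" "s < real m" "0 < h" "0 \<le> A"
  shows "(\<integral>\<^sup>+u. fdiff_majorant A s m h u \<partial>lborel) \<le>
    ennreal ((2 ^ m * (A * (2 * ((2 * real m) powr s / s)))
      + 2 * (A * (real m powr (s - real m) / (real m - s)))) * h powr s)"
proof -
  have m: "0 < real m" using assms by linarith
  define R where "R = 2 * real m * h"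
  have R: "0 \<le> R" using assms by (simp add: R_def)
  define near where "near = (\<lambda>v::real. ennreal (\<bar>v\<bar> powr (s - 1)) * indicator {-R..R} v)"
  define far where "far = (\<lambda>v::real. ennreal (v powr (s - 1 - real m)) * indicator {real m * h..} v)"
  have [measurable]: "near \<in> borel_measurable borel" "far \<in> borel_measurable borel"
    unfolding near_def far_def by measurable
  have "(\<integral>\<^sup>+u. near u \<partial>lborel) \<le> ennreal (2 * (R powr s / s))"
    unfolding near_def using assms R by (intro nn_integral_powr_near_0)
  also have "R powr s = (2 * real m) powr s * h powr s"
    unfolding R_def by (rule powr_mult)
  finally have near: "(\<integral>\<^sup>+u. near u \<partial>lborel) \<le> ennreal (2 * ((2 * real m) powr s / s) * h powr s)"
    by (simp add: mult.assoc)
  have "(\<integral>\<^sup>+u. far u \<partial>lborel) = ennreal ((real m * h) powr (s - 1 - real m + 1) / (- (s - 1 - real m) - 1))"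
    unfolding far_def using assms m by (intro nn_integral_powr_tail) auto
  then have "(\<integral>\<^sup>+u. far u \<partial>lborel) = ennreal (real m powr (s - real m) / (real m - s) * h powr (s - real m))"
    by (simp add: powr_mult)
  then have "ennreal (A * h ^ m) * (\<integral>\<^sup>+u. far u \<partial>lborel)
      = ennreal (A * h ^ m * (real m powr (s - real m) / (real m - s) * h powr (s - real m)))"
    using assms by (simp only:) (subst ennreal_mult''[symmetric], auto)
  also have "A * h ^ m * (real m powr (s - real m) / (real m - s) * h powr (s - real m))
      = A * (real m powr (s - real m) / (real m - s)) * (h powr real m * h powr (s - real m))"
    using assms by (simp add: powr_realpow)
  also have "h powr real m * h powr (s - real m) = h powr s" by (simp flip: powr_add)
  finally have far: "ennreal (A * h ^ m) * (\<integral>\<^sup>+u. far u \<partial>lborel)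
      = ennreal (A * (real m powr (s - real m) / (real m - s)) * h powr s)" .
  have "(\<integral>\<^sup>+u. fdiff_majorant A s m h u \<partial>lborel)
    = (\<Sum>i\<le>m. ennreal (real (m choose i) * A) * (\<integral>\<^sup>+u. near (u + (real m - real i) * h) \<partial>lborel))
     + (ennreal (A * h ^ m) * (\<integral>\<^sup>+u. far u \<partial>lborel)
      + ennreal (A * h ^ m) * (\<integral>\<^sup>+u. far (- (real m * h) - u) \<partial>lborel))"
    unfolding fdiff_majorant_def R_def[symmetric]
    by (simp add: nn_integral_add nn_integral_sum nn_integral_cmult near_def far_def)
  also have "\<dots> = (\<Sum>i\<le>m. ennreal (real (m choose i) * A) * (\<integral>\<^sup>+u. near u \<partial>lborel))
     + (ennreal (A * h ^ m) * (\<integral>\<^sup>+u. far u \<partial>lborel) + ennreal (A * h ^ m) * (\<integral>\<^sup>+u. far u \<partial>lborel))"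
    by (simp add: nn_integral_shift)
  also have "\<dots> \<le> (\<Sum>i\<le>m. ennreal (real (m choose i) * A) * ennreal (2 * ((2 * real m) powr s / s) * h powr s))
     + (ennreal (A * h ^ m) * (\<integral>\<^sup>+u. far u \<partial>lborel) + ennreal (A * h ^ m) * (\<integral>\<^sup>+u. far u \<partial>lborel))"
    by (intro add_right_mono sum_mono mult_left_mono near) auto
  also have "\<dots> = ennreal ((\<Sum>i\<le>m. real (m choose i) * A * (2 * ((2 * real m) powr s / s) * h powr s))
     + (A * (real m powr (s - real m) / (real m - s)) * h powr s
       + A * (real m powr (s - real m) / (real m - s)) * h powr s))"
    unfolding far using assms
    by (simp add: ennreal_mult[symmetric] sum_nonneg flip: ennreal_plus)
  also have "(\<Sum>i\<le>m. real (m choose i) * A * (2 * ((2 * real m) powr s / s) * h powr s))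
    = (\<Sum>i\<le>m. real (m choose i)) * (A * (2 * ((2 * real m) powr s / s) * h powr s))"
    unfolding sum_distrib_right by (simp only: mult.assoc)
  also have "(\<Sum>i\<le>m. real (m choose i)) = 2 ^ m" 
    using choose_row_sum[of m] by (metis of_nat_numeral of_nat_power of_nat_sum)
  finally show ?thesis by (simp add: algebra_simps)
qed

lemma abs_fdiff_le_majorant:
  assumes p: "p 0 = 0" "\<And>u. p (- u) = p u"
    and deriv: "\<And>j v. 0 < v \<Longrightarrow> (D j has_real_derivative D (Suc j) v) (at v)" "D 0 = p"
    and bnd0: "\<And>v. 0 < v \<Longrightarrow> v \<le> 4 \<Longrightarrow> \<bar>p v\<bar> \<le> A * v powr (s - 1)"
    and bndm: "\<And>v. 0 < v \<Longrightarrow> v \<le> 4 \<Longrightarrow> \<bar>D m v\<bar> \<le> A * v powr (s - 1 - real m)"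
    and "0 < s" "s < real m" "0 < h" "0 \<le> A"
    and u: "\<bar>u\<bar> \<le> 2" "\<bar>u + real m * h\<bar> \<le> 2"
  shows "ennreal \<bar>fdiff m h p u\<bar> \<le> fdiff_majorant A s m h u"
proof -
  have m: "0 < real m" using assms by linarith
  then have mh: "0 < real m * h" using \<open>0 < h\<close> by simp
  have far: "\<bar>fdiff m h p v\<bar> \<le> A * h ^ m * v powr (s - 1 - real m)"
    if v: "real m * h \<le> v" "v + real m * h \<le> 2" for v
  proof -
    have "0 < v" using v mh by linarith
    have "\<bar>fdiff m h (D 0) v\<bar> \<le> h ^ m * (A * v powr (s - 1 - real m))"
    proof (rule abs_fdiff_le_deriv)
      fix \<xi> assume \<xi>: "v \<le> \<xi>" "\<xi> \<le> v + real m * h"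
      then have "\<bar>D m \<xi>\<bar> \<le> A * \<xi> powr (s - 1 - real m)" using v mh \<open>0 < v\<close> by (intro bndm) auto
      also have "\<dots> \<le> A * v powr (s - 1 - real m)"
        using \<xi> \<open>0 < v\<close> assms by (intro mult_left_mono powr_mono2') auto
      finally show "\<bar>D m \<xi>\<bar> \<le> A * v powr (s - 1 - real m)" .
    qed (use deriv \<open>0 < v\<close> \<open>0 < h\<close> in auto)
    then show ?thesis by (simp add: deriv mult_ac)
  qed
  \<comment> \<open>Each of the three regions needs only one part of the majorant.\<close>
  have split: "a \<le> X + (Y + Z)" if "a \<le> X \<or> a \<le> Y \<or> a \<le> Z" for a X Y Z :: ennreal
    using that by (metis add_increasing add_increasing2 zero_le)
  consider "real m * h \<le> u" | "real m * h \<le> - (real m * h) - u"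
    | "u < real m * h" "- 2 * (real m * h) < u" by linarith
  then show ?thesis
  proof cases
    case 1
    have "ennreal \<bar>fdiff m h p u\<bar> \<le> ennreal (A * h ^ m * u powr (s - 1 - real m))"
      using 1 u by (intro ennreal_leI far) auto
    then show ?thesis unfolding fdiff_majorant_def using 1 assms
      by (intro split disjI2 disjI1) (auto simp: ennreal_mult'')
  next
    case 2
    have "ennreal \<bar>fdiff m h p (- u - real m * h)\<bar>
        \<le> ennreal (A * h ^ m * (- u - real m * h) powr (s - 1 - real m))"
      using 2 u by (intro ennreal_leI far) auto
    then have "ennreal \<bar>fdiff m h p u\<bar>
        \<le> ennreal (A * h ^ m * (- (real m * h) - u) powr (s - 1 - real m))"
      unfolding abs_fdiff_even[of p, OF p(2)] by (simp only: minus_diff_commute)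
    then show ?thesis unfolding fdiff_majorant_def using 2 assms
      by (intro split disjI2) (auto simp: ennreal_mult'')
  next
    case 3
    have bnd: "\<bar>p v\<bar> \<le> A * \<bar>v\<bar> powr (s - 1)" if "\<bar>v\<bar> \<le> 4" for v
    proof (cases "0 < v")
      case True
      then show ?thesis using bnd0[of v] that by simp
    next
      case False
      then show ?thesis using bnd0[of "- v"] that p by (cases "v = 0") auto
    qed
    have "\<bar>fdiff m h p u\<bar> \<le> (\<Sum>i\<le>m. real (m choose i) * \<bar>p (u + (real m - real i) * h)\<bar>)"
      by (rule abs_fdiff_le_sum)
    also have "\<dots> \<le> (\<Sum>i\<le>m. real (m choose i) * A * (\<bar>u + (real m - real i) * h\<bar> powr (s - 1)
        * indicator {- (2 * real m * h)..2 * real m * h} (u + (real m - real i) * h)))"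
    proof (rule sum_mono)
      fix i assume "i \<in> {..m}"
      then have i: "0 \<le> (real m - real i) * h" "(real m - real i) * h \<le> real m * h"
        using \<open>0 < h\<close> by (auto intro: mult_right_mono)
      then have "\<bar>u + (real m - real i) * h\<bar> \<le> 4" using u by (auto simp: abs_if split: if_splits)
      then have "\<bar>p (u + (real m - real i) * h)\<bar> \<le> A * \<bar>u + (real m - real i) * h\<bar> powr (s - 1)"
        by (rule bnd)
      moreover have "u + (real m - real i) * h \<in> {- (2 * real m * h)..2 * real m * h}"
        using 3 i mh by auto
      ultimately show "real (m choose i) * \<bar>p (u + (real m - real i) * h)\<bar>
        \<le> real (m choose i) * A * (\<bar>u + (real m - real i) * h\<bar> powr (s - 1)
        * indicator {- (2 * real m * h)..2 * real m * h} (u + (real m - real i) * h))"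
        by (simp add: mult.assoc mult_left_mono)
    qed
    finally have "ennreal \<bar>fdiff m h p u\<bar> \<le> ennreal (\<Sum>i\<le>m. real (m choose i) * A
        * (\<bar>u + (real m - real i) * h\<bar> powr (s - 1)
        * indicator {- (2 * real m * h)..2 * real m * h} (u + (real m - real i) * h)))"
      by (rule ennreal_leI)
    also have "\<dots> = (\<Sum>i\<le>m. ennreal (real (m choose i) * A) *
        (ennreal (\<bar>u + (real m - real i) * h\<bar> powr (s - 1))
          * indicator {- (2 * real m * h)..2 * real m * h} (u + (real m - real i) * h)))"
      using \<open>0 \<le> A\<close> by (subst sum_ennreal[symmetric]) (auto simp: ennreal_mult ennreal_indicator)
    finally show ?thesis unfolding fdiff_majorant_def by (intro split disjI1)
  qed
qed

section \<open>Convolution with a weakly singular kernel\<close>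

definition convolve :: "(real \<Rightarrow> real) \<Rightarrow> (real \<Rightarrow> real) \<Rightarrow> real \<Rightarrow> real" where
  "convolve F p y = (\<integral>x. F x * p (y - x) \<partial>lborel)"

lemma integrable_convolve:
  assumes F: "F \<in> borel_measurable borel" "\<And>x. \<bar>F x\<bar> \<le> B" "\<And>x. x \<notin> {-1..1} \<Longrightarrow> F x = 0"
    and p: "weakly_singular s p" "0 < s" and y: "y \<in> {-1..1}"
  shows "integrable lborel (\<lambda>x. F x * p (y - x))"
proof (rule integrableI_bounded)
  obtain D A where D: "D 0 = p" 
    and A: "\<And>j v. 0 < v \<Longrightarrow> v \<le> 4 \<Longrightarrow> \<bar>D j v\<bar> \<le> A j * v powr (s - 1 - real j)"
    and p': "p \<in> borel_measurable borel" "p 0 = 0" "\<And>u. p (- u) = p u"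
    using p(1) unfolding weakly_singular_def by blast
  note [measurable] = F(1) p'(1)
  show "(\<lambda>x. F x * p (y - x)) \<in> borel_measurable lborel" by measurable
  define f where "f = (\<lambda>v::real. ennreal (\<bar>v\<bar> powr (s - 1)) * indicator {-2..2} v)"
  have [measurable]: "f \<in> borel_measurable borel" unfolding f_def by measurable
  have B: "0 \<le> B" using F(2)[of 0] by linarith
  have A0: "\<bar>p v\<bar> \<le> \<bar>A 0\<bar> * \<bar>v\<bar> powr (s - 1)" if "\<bar>v\<bar> \<le> 4" for v
  proof (cases "v = 0")
    case False
    have "\<bar>p v\<bar> = \<bar>p \<bar>v\<bar>\<bar>" using p'(3)[of v] by (simp add: abs_if)
    also have "\<dots> \<le> A 0 * \<bar>v\<bar> powr (s - 1)" using A[of "\<bar>v\<bar>" 0] False that D by simp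
    also have "\<dots> \<le> \<bar>A 0\<bar> * \<bar>v\<bar> powr (s - 1)" by (intro mult_right_mono) auto
    finally show ?thesis .
  qed (simp add: p')
  have "(\<integral>\<^sup>+x. ennreal (norm (F x * p (y - x))) \<partial>lborel)
      \<le> (\<integral>\<^sup>+x. ennreal (B * \<bar>A 0\<bar>) * f (y - x) \<partial>lborel)"
  proof (rule nn_integral_mono)
    fix x :: real
    show "ennreal (norm (F x * p (y - x))) \<le> ennreal (B * \<bar>A 0\<bar>) * f (y - x)"
    proof (cases "x \<in> {-1..1}")
      case True
      have "norm (F x * p (y - x)) \<le> B * (\<bar>A 0\<bar> * \<bar>y - x\<bar> powr (s - 1))"
        unfolding real_norm_def abs_mult using True y B F(2)[of x]
        by (intro mult_mono A0) auto
      then have "ennreal (norm (F x * p (y - x))) \<le> ennreal (B * \<bar>A 0\<bar> * \<bar>y - x\<bar> powr (s - 1))"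
        by (intro ennreal_leI) (simp add: mult.assoc)
      also have "\<dots> = ennreal (B * \<bar>A 0\<bar>) * f (y - x)"
        using True y by (simp add: f_def ennreal_mult'' indicator_def)
      finally show ?thesis .
    qed (simp add: F)
  qed
  also have "\<dots> = ennreal (B * \<bar>A 0\<bar>) * (\<integral>\<^sup>+x. f x \<partial>lborel)"
    by (subst nn_integral_cmult) (simp_all add: nn_integral_shift)
  also have "(\<integral>\<^sup>+x. f x \<partial>lborel) \<le> ennreal (2 * (2 powr s / s))"
    unfolding f_def using p(2) by (intro nn_integral_powr_near_0) auto
  also have "ennreal (B * \<bar>A 0\<bar>) * ennreal (2 * (2 powr s / s)) < \<infinity>"
    by (simp add: ennreal_mult_less_top)
  finally show "(\<integral>\<^sup>+x. ennreal (norm (F x * p (y - x))) \<partial>lborel) < \<infinity>"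
    by (simp add: mult_left_mono)
qed

lemma fdiff_convolve:
  assumes int: "\<And>y. y \<in> {-1..1} \<Longrightarrow> integrable lborel (\<lambda>x. F x * p (y - x))"
    and "0 \<le> h" "y \<in> {-1..1}" "y + real m * h \<in> {-1..1}"
  shows "integrable lborel (\<lambda>x. F x * fdiff m h p (y - x))
    \<and> fdiff m h (convolve F p) y = (\<integral>x. F x * fdiff m h p (y - x) \<partial>lborel)"
  using assms(3,4)
proof (induction m arbitrary: y)
  case 0
  then show ?case using int by (simp add: convolve_def)
next
  case (Suc m)
  have mh: "0 \<le> real m * h" using \<open>0 \<le> h\<close> by simp
  have end_eq: "y + real (Suc m) * h = y + h + real m * h" by (simp add: distrib_right)
  have "y + h \<in> {-1..1}" "y + h + real m * h \<in> {-1..1}" "y + real m * h \<in> {-1..1}"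
    using Suc.prems \<open>0 \<le> h\<close> mh unfolding end_eq atLeastAtMost_iff by linarith+
  note IH = Suc.IH[OF this(1,2)] Suc.IH[OF Suc.prems(1) this(3)]
  have eq: "F x * fdiff (Suc m) h p (y - x)
      = F x * fdiff m h p (y + h - x) - F x * fdiff m h p (y - x)" for x
    by (simp add: algebra_simps)
  show ?case unfolding eq fdiff.simps(2)[of m h "convolve F p"] using IH by simp
qed

text \<open>
  The difference falls on the kernel, \<open>F\<close> is bounded by \<open>B\<close>, and the remaining integral of the majorant
  does not depend on \<open>y\<close>.
\<close>

lemma abs_fdiff_convolve_le:
  assumes F: "F \<in> borel_measurable borel" "\<And>x. \<bar>F x\<bar> \<le> B" "\<And>x. x \<notin> {-1..1} \<Longrightarrow> F x = 0"
    and p: "weakly_singular s p" and s: "0 < s" "s < real m"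
  obtains K where "0 \<le> K" and "\<And>y h. 0 < h \<Longrightarrow> y \<in> {-1..1} \<Longrightarrow> y + real m * h \<in> {-1..1} \<Longrightarrow>
    \<bar>fdiff m h (convolve F p) y\<bar> \<le> K * h powr s"
proof -
  obtain D A where D: "D 0 = p" "\<And>j v. 0 < v \<Longrightarrow> (D j has_real_derivative D (Suc j) v) (at v)"
    and A: "\<And>j v. 0 < v \<Longrightarrow> v \<le> 4 \<Longrightarrow> \<bar>D j v\<bar> \<le> A j * v powr (s - 1 - real j)"
    and p': "p \<in> borel_measurable borel" "p 0 = 0" "\<And>u. p (- u) = p u"
    using p(1) unfolding weakly_singular_def by blast
  define a where "a = max \<bar>A 0\<bar> \<bar>A m\<bar>"
  have a: "0 \<le> a" by (simp add: a_def le_max_iff_disj)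
  have bnd: "\<bar>D j v\<bar> \<le> a * v powr (s - 1 - real j)" if "0 < v" "v \<le> 4" "j = 0 \<or> j = m" for j v
  proof -
    have "A j \<le> a" using that(3) by (auto simp: a_def)
    then have "A j * v powr (s - 1 - real j) \<le> a * v powr (s - 1 - real j)" by (intro mult_right_mono) auto
    then show ?thesis using A[OF that(1,2), of j] by linarith
  qed
  have B: "0 \<le> B" using F(2)[of 0] by linarith
  define K where "K = 2 ^ m * (a * (2 * ((2 * real m) powr s / s)))
      + 2 * (a * (real m powr (s - real m) / (real m - s)))"
  have K: "0 \<le> K" using a s by (simp add: K_def)
  show thesis
  proof (rule that[of "B * K"])
    show "0 \<le> B * K" using B K by simp
    fix y h :: real assume h: "0 < h" and y: "y \<in> {-1..1}" "y + real m * h \<in> {-1..1}"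
    have conv: "integrable lborel (\<lambda>x. F x * fdiff m h p (y - x))"
      "fdiff m h (convolve F p) y = (\<integral>x. F x * fdiff m h p (y - x) \<partial>lborel)"
      using fdiff_convolve[OF integrable_convolve[OF F p s(1)] less_imp_le[OF h] y] by auto
    have "ennreal \<bar>fdiff m h (convolve F p) y\<bar> \<le> (\<integral>\<^sup>+x. norm (F x * fdiff m h p (y - x)) \<partial>lborel)"
      unfolding conv(2) real_norm_def[symmetric] by (rule integral_norm_bound_ennreal[OF conv(1)])
    also have "\<dots> \<le> (\<integral>\<^sup>+x. ennreal B * fdiff_majorant a s m h (y - x) \<partial>lborel)"
    proof (rule nn_integral_mono)
      fix x :: real
      show "ennreal (norm (F x * fdiff m h p (y - x))) \<le> ennreal B * fdiff_majorant a s m h (y - x)"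
      proof (cases "x \<in> {-1..1}")
        case True
        have "ennreal (norm (F x * fdiff m h p (y - x))) = ennreal \<bar>F x\<bar> * ennreal \<bar>fdiff m h p (y - x)\<bar>"
          by (simp add: abs_mult ennreal_mult)
        also have "\<dots> \<le> ennreal B * fdiff_majorant a s m h (y - x)"
        proof (intro mult_mono ennreal_leI F(2) abs_fdiff_le_majorant[where D=D])
          show "\<bar>p v\<bar> \<le> a * v powr (s - 1)" if "0 < v" "v \<le> 4" for v
            using bnd[OF that, of 0] D by simp
          show "\<bar>D m v\<bar> \<le> a * v powr (s - 1 - real m)" if "0 < v" "v \<le> 4" for v
            using bnd[OF that, of m] by simp
          show "\<bar>y - x\<bar> \<le> 2" "\<bar>y - x + real m * h\<bar> \<le> 2" using True y by auto
        qed (use D p' s h a in auto)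
        finally show ?thesis .
      qed (simp add: F)
    qed
    also have "\<dots> = ennreal B * (\<integral>\<^sup>+u. fdiff_majorant a s m h u \<partial>lborel)"
      by (subst nn_integral_cmult) (simp_all add: nn_integral_shift)
    also have "\<dots> \<le> ennreal B * ennreal (K * h powr s)"
      unfolding K_def by (intro mult_left_mono nn_integral_fdiff_majorant s h a) auto
    also have "\<dots> = ennreal (B * K * h powr s)" using B K by (simp add: ennreal_mult' mult.assoc)
    finally show "\<bar>fdiff m h (convolve F p) y\<bar> \<le> B * K * h powr s"
      using B K by (subst (asm) ennreal_le_iff) auto
  qed
qed

text \<open>
  The previous estimate for first differences is a Hoelder condition. It needs an exponent below
  \<open>1\<close>, hence the minimum with \<open>1 / 2\<close>.
\<close>

lemma continuous_on_convolve:
  assumes F: "F \<in> borel_measurable borel" "\<And>x. \<bar>F x\<bar> \<le> B" "\<And>x. x \<notin> {-1..1} \<Longrightarrow> F x = 0"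
    and p: "weakly_singular s p" and s: "0 < s"
  shows "continuous_on {-1..1} (convolve F p)"
proof -
  define r where "r = min s (1 / 2)"
  have r: "0 < r" "r < real 1" using s by (auto simp: r_def)
  have "weakly_singular r p" using p by (rule weakly_singular_mono) (simp add: r_def)
  then obtain K where "0 \<le> K" and K: "\<And>y h. 0 < h \<Longrightarrow> y \<in> {-1..1} \<Longrightarrow> y + real 1 * h \<in> {-1..1} \<Longrightarrow>
    \<bar>fdiff 1 h (convolve F p) y\<bar> \<le> K * h powr r"
    using abs_fdiff_convolve_le[OF F _ r] by blast
  have up: "\<bar>convolve F p z - convolve F p y\<bar> \<le> K * \<bar>z - y\<bar> powr r"
    if "y \<in> {-1..1}" "z \<in> {-1..1}" "y < z" for y z
    using K[of "z - y" y] that by simp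
  have hoelder: "\<bar>convolve F p z - convolve F p y\<bar> \<le> K * \<bar>z - y\<bar> powr r"
    if "y \<in> {-1..1}" "z \<in> {-1..1}" for y z
    using up[of y z] up[of z y] that by (cases y z rule: linorder_cases) (auto simp: abs_minus_commute)
  show ?thesis unfolding continuous_on_def
  proof
    fix y :: real assume y: "y \<in> {-1..1}"
    have "((\<lambda>z. K * \<bar>z - y\<bar> powr r) \<longlongrightarrow> K * \<bar>y - y\<bar> powr r) (at y within {-1..1})"
      using r by (intro tendsto_intros tendsto_powr') auto
    then have "((\<lambda>z. K * \<bar>z - y\<bar> powr r) \<longlongrightarrow> 0) (at y within {-1..1})" by simp
    moreover have "\<forall>\<^sub>F z in at y within {-1..1}.
        norm (convolve F p z - convolve F p y) \<le> K * \<bar>z - y\<bar> powr r"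
      using hoelder[OF y] by (auto simp: eventually_at_filter)
    ultimately have "((\<lambda>z. convolve F p z - convolve F p y) \<longlongrightarrow> 0) (at y within {-1..1})"
      by (rule Lim_null_comparison[rotated])
    then show "(convolve F p \<longlongrightarrow> convolve F p y) (at y within {-1..1})"
      by (simp add: LIM_zero_iff)
  qed
qed

lemma convolve_in_zygmund:
  assumes F: "F \<in> borel_measurable borel" "\<And>x. \<bar>F x\<bar> \<le> B" "\<And>x. x \<notin> {-1..1} \<Longrightarrow> F x = 0"
    and p: "weakly_singular s p" and s: "0 < s" "s < real m"
  shows "convolve F p \<in> zygmund m s"
proof (rule zygmund_if_interior_smooth)
  have m: "0 < real m" using s by linarith
  then show "0 < m" by simp
  show "convolve F p \<in> C0" unfolding C0_def using continuous_on_convolve[OF F p s(1)] by simp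
  obtain K where "0 \<le> K" and K: "\<And>y h. 0 < h \<Longrightarrow> y \<in> {-1..1} \<Longrightarrow> y + real m * h \<in> {-1..1} \<Longrightarrow>
    \<bar>fdiff m h (convolve F p) y\<bar> \<le> K * h powr s"
    using abs_fdiff_convolve_le[OF F p s] by blast
  show "interior_smooth m s (convolve F p)"
  proof (rule interior_smoothI[where c="1 / real m" and C=K])
    show c: "0 < 1 / real m" using m by simp
    fix x h :: real assume h: "0 < h" "h \<le> 1 / real m * (1 - \<bar>x\<bar>)"
    have d: "0 < 1 - \<bar>x\<bar>" using h c by (rule pos_of_le_mult)
    have "real m * h \<le> 1 - \<bar>x\<bar>" using h(2) m by (simp add: field_simps)
    moreover have "0 < real m * h" using m h by simp
    ultimately have "x \<in> {-1..1}" "x + real m * h \<in> {-1..1}" using d by (auto simp: abs_if split: if_splits)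
    then have "\<bar>fdiff m h (convolve F p) x\<bar> \<le> K * h powr s" using K h by blast
    also have "\<dots> \<le> K * (h / sqrt (1 - \<bar>x\<bar>)) powr s"
    proof -
      have "h \<le> h / sqrt (1 - \<bar>x\<bar>)" using d h by (simp add: field_simps)
      then show ?thesis using h s \<open>0 \<le> K\<close> by (intro mult_left_mono powr_mono2) auto
    qed
    finally show "\<bar>fdiff m h (convolve F p) x\<bar> \<le> K * (h / sqrt (1 - \<bar>x\<bar>)) powr s" .
  qed
qed (use s in simp)

lemma integral_kernel_in_zygmund:
  assumes f: "F \<in> C0"
    and p: "weakly_singular s p" and s: "0 < s" "s < real m"
  shows "(\<lambda>y. LBINT x:{-1..1}. F x * p (x - y)) \<in> zygmund m s"
proof -
  define F' where "F' = (\<lambda>x. indicator {-1..1} x * F x)"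
  obtain B where B: "0 \<le> B" "\<And>x. x \<in> {-1..1} \<Longrightarrow> \<bar>F x\<bar> \<le> B" using C0_bounded[OF f] by blast
  have "set_integrable lborel {-1..1} F"
    using f by (intro borel_integrable_atLeastAtMost') (simp add: C0_def)
  then have "F' \<in> borel_measurable borel"
    unfolding set_integrable_def F'_def by (auto dest: borel_measurable_integrable)
  moreover have "\<bar>F' x\<bar> \<le> B" for x using B by (auto simp: F'_def indicator_def)
  moreover have "F' x = 0" if "x \<notin> {-1..1}" for x using that by (simp add: F'_def)
  ultimately have "convolve F' p \<in> zygmund m s" using p s by (rule convolve_in_zygmund)
  moreover have "convolve F' p = (\<lambda>y. LBINT x:{-1..1}. F x * p (x - y))"
  proof
    fix y
    have "p (y - x) = p (x - y)" for x
      using p unfolding weakly_singular_def by (metis minus_diff_eq)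
    then show "convolve F' p y = (LBINT x:{-1..1}. F x * p (x - y))"
      by (simp add: convolve_def set_lebesgue_integral_def F'_def mult.assoc)
  qed
  ultimately show ?thesis by simp
qed

lemma Ktilde_op_in_zygmund:
  assumes "\<psi> \<in> C0" "f \<in> C0" and s: "0 < s" "s < real m"
    and s_le: "if \<mu> = 0 then s < 1 else s \<le> \<mu> + 1"
  shows "Ktilde_op \<psi> \<mu> f \<in> zygmund m s"
proof -
  have F: "(\<lambda>x. \<psi> x * f x) \<in> C0" using assms by (simp add: C0_def continuous_on_mult)
  show ?thesis
  proof (cases "\<mu> = 0")
    case True
    have "Ktilde_op \<psi> \<mu> f = (\<lambda>y. LBINT x:{-1..1}. \<psi> x * f x * ln \<bar>x - y\<bar>)"
      unfolding Ktilde_op_def using True by (simp add: mult_ac)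
    then show ?thesis
      using integral_kernel_in_zygmund[OF F weakly_singular_ln s] True s s_le by simp
  next
    case False
    have "Ktilde_op \<psi> \<mu> f = (\<lambda>y. LBINT x:{-1..1}. \<psi> x * f x * \<bar>x - y\<bar> powr \<mu>)"
      unfolding Ktilde_op_def using False by (simp add: mult_ac)
    moreover have "weakly_singular s (\<lambda>u. \<bar>u\<bar> powr \<mu>)"
      using weakly_singular_powr by (rule weakly_singular_mono) (use False s_le in simp)
    ultimately show ?thesis using integral_kernel_in_zygmund[OF F _ s] by simp
  qed
qed

lemma H_op_in_C0:
  assumes "continuous_on ({-1..1} \<times> UNIV) (\<lambda>(x, u). h x u)" "f \<in> C0"
  shows "H_op h f \<in> C0"
proof -
  have "continuous_on {-1..1} (\<lambda>x. (\<lambda>(x, u). h x u) (x, f x))"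
    using assms(2) by (intro continuous_on_compose2[OF assms(1)] continuous_intros) (auto simp: C0_def)
  then show ?thesis by (simp add: C0_def H_op_def[abs_def])
qed

section \<open>The continuous kernel\<close>

lemma continuous_on_kernel_times:
  assumes "continuous_on ({-1..1} \<times> {-1..1}) (\<lambda>(x, y). k1 x y)" "f \<in> C0" "y \<in> {-1..1}"
  shows "continuous_on {-1..1} (\<lambda>x. k1 x y * f x)"
proof -
  have "continuous_on {-1..1} (\<lambda>x. (\<lambda>(x, y). k1 x y) (x, y))"
    by (rule continuous_on_compose2[OF assms(1)]) (use assms(3) in \<open>auto intro!: continuous_intros\<close>)
  then have "continuous_on {-1..1} (\<lambda>x. k1 x y)" by simp
  then show ?thesis using assms(2) unfolding C0_def mem_Collect_eq by (rule continuous_on_mult)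
qed

lemma K1_op_eq_integral:
  assumes "continuous_on ({-1..1} \<times> {-1..1}) (\<lambda>(x, y). k1 x y)" "f \<in> C0" "y \<in> {-1..1}"
  shows "K1_op k1 f y = integral {-1..1} (\<lambda>x. k1 x y * f x)"
  unfolding K1_op_def
  by (rule set_borel_integral_eq_integral(2)[OF borel_integrable_atLeastAtMost'[OF continuous_on_kernel_times[OF assms]]])

lemma K1_op_in_C0:
  assumes k1: "continuous_on ({-1..1} \<times> {-1..1}) (\<lambda>(x, y). k1 x y)" and f: "f \<in> C0"
  shows "K1_op k1 f \<in> C0"
proof -
  have "continuous_on ({-1..1} \<times> {-1..1}) (\<lambda>z. (\<lambda>(x, y). k1 x y) (snd z, fst z))"
    by (rule continuous_on_compose2[OF k1]) (auto intro!: continuous_intros)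
  moreover have "continuous_on ({-1..1} \<times> {-1..1}) (\<lambda>z::real \<times> real. f (snd z))"
    by (rule continuous_on_compose2[of "{-1..1}" f])
      (use f in \<open>auto simp: C0_def intro!: continuous_intros\<close>)
  ultimately have "continuous_on ({-1..1} \<times> {-1..1}) (\<lambda>z. (\<lambda>(x, y). k1 x y) (snd z, fst z) * f (snd z))"
    by (rule continuous_on_mult)
  then have "continuous_on ({-1..1} \<times> cbox (-1) 1) (\<lambda>(y, x). k1 x y * f x)"
    by (simp add: case_prod_unfold)
  from integral_continuous_on_param[OF this]
  have "continuous_on {-1..1} (\<lambda>y. integral {-1..1} (\<lambda>x. k1 x y * f x))"
    by (simp only: cbox_interval)
  moreover have "continuous_on {-1..1} (K1_op k1 f) \<longleftrightarrow>
      continuous_on {-1..1} (\<lambda>y. integral {-1..1} (\<lambda>x. k1 x y * f x))"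
    by (rule continuous_on_cong[OF refl K1_op_eq_integral[OF k1 f]])
  ultimately show ?thesis by (simp only: C0_def mem_Collect_eq)
qed

lemma phi_diff_K1_op:
  assumes k1: "continuous_on ({-1..1} \<times> {-1..1}) (\<lambda>(x, y). k1 x y)" and f: "f \<in> C0"
    and y: "y \<in> main_part k \<tau>" "0 < \<tau>" "0 < k"
  shows "continuous_on {-1..1} (\<lambda>x. phi_diff k \<tau> (k1 x) y * f x)"
    and "phi_diff k \<tau> (K1_op k1 f) y = integral {-1..1} (\<lambda>x. phi_diff k \<tau> (k1 x) y * f x)"
proof -
  define z where "z = (\<lambda>i. y + \<tau> * phi y / 2 * (real k - 2 * real i))"
  have z: "z i \<in> {-1..1}" if "i \<in> {0..k}" for i
    unfolding z_def using main_part_points[OF y] that by simp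
  have cont: "continuous_on {-1..1} (\<lambda>x. (-1) ^ i * real (k choose i) * (k1 x (z i) * f x))"
    if "i \<in> {0..k}" for i
    by (rule continuous_on_mult_left[OF continuous_on_kernel_times[OF k1 f z[OF that]]])
  have eq: "phi_diff k \<tau> (k1 x) y * f x
      = (\<Sum>i=0..k. (-1) ^ i * real (k choose i) * (k1 x (z i) * f x))" for x
    unfolding phi_diff_def z_def sum_distrib_right by (simp only: mult.assoc)
  show "continuous_on {-1..1} (\<lambda>x. phi_diff k \<tau> (k1 x) y * f x)"
    unfolding eq by (rule continuous_on_sum) (rule cont)
  have "phi_diff k \<tau> (K1_op k1 f) y = (\<Sum>i=0..k. (-1) ^ i * real (k choose i) * K1_op k1 f (z i))"
    unfolding phi_diff_def z_def ..
  also have "\<dots> = (\<Sum>i=0..k. integral {-1..1} (\<lambda>x. (-1) ^ i * real (k choose i) * (k1 x (z i) * f x)))"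
    by (rule sum.cong[OF refl]) (simp only: K1_op_eq_integral[OF k1 f z] integral_mult_right)
  also have "\<dots> = integral {-1..1} (\<lambda>x. \<Sum>i=0..k. (-1) ^ i * real (k choose i) * (k1 x (z i) * f x))"
    by (rule integral_sum[symmetric]) (simp, rule integrable_continuous_interval, rule cont)
  finally show "phi_diff k \<tau> (K1_op k1 f) y = integral {-1..1} (\<lambda>x. phi_diff k \<tau> (k1 x) y * f x)"
    unfolding eq .
qed

lemma K1_op_in_zygmund:
  assumes k1: "continuous_on ({-1..1} \<times> {-1..1}) (\<lambda>(x, y). k1 x y)"
    and zyg: "(SUP x\<in>{-1..1}. zyg_norm k lam (k1 x)) < \<infinity>"
    and f: "f \<in> C0" and lam: "0 \<le> lam" and k: "0 < k"
  shows "K1_op k1 f \<in> zygmund k lam"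
proof -
  obtain C where C: "0 \<le> C" "(SUP x\<in>{-1..1}. zyg_norm k lam (k1 x)) = ennreal C"
    using zyg by (cases "SUP x\<in>{-1..1}. zyg_norm k lam (k1 x)") auto
  have k1_diff: "\<bar>phi_diff k \<tau> (k1 x) y\<bar> \<le> C * \<tau> powr lam"
    if "x \<in> {-1..1}" "0 < \<tau>" "y \<in> main_part k \<tau>" for x y \<tau>
  proof -
    have "zyg_seminorm k lam (k1 x) \<le> zyg_norm k lam (k1 x)" by (simp add: zyg_norm_def)
    also have "\<dots> \<le> ennreal C" unfolding C(2)[symmetric] using that(1) by (rule SUP_upper)
    finally show ?thesis unfolding zyg_seminorm_le_iff[OF C(1) lam] using that(2,3) by simp
  qed
  obtain B where B: "0 \<le> B" "\<And>x. x \<in> {-1..1} \<Longrightarrow> \<bar>f x\<bar> \<le> B" using C0_bounded[OF f] by blast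
  have "\<bar>phi_diff k \<tau> (K1_op k1 f) y\<bar> \<le> 2 * C * B * \<tau> powr lam"
    if \<tau>: "0 < \<tau>" and y: "y \<in> main_part k \<tau>" for \<tau> y
  proof -
    have "norm (integral {-1..1} (\<lambda>x. phi_diff k \<tau> (k1 x) y * f x)) \<le> C * \<tau> powr lam * B * (1 - - 1)"
    proof (rule integral_bound)
      show "continuous_on {-1..1} (\<lambda>x. phi_diff k \<tau> (k1 x) y * f x)"
        by (rule phi_diff_K1_op[OF k1 f y \<tau> k])
      fix x :: real assume x: "x \<in> {-1..1}"
      show "norm (phi_diff k \<tau> (k1 x) y * f x) \<le> C * \<tau> powr lam * B"
        unfolding real_norm_def abs_mult using k1_diff[OF x \<tau> y] B(2)[OF x] C(1)
        by (intro mult_mono) auto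
    qed simp
    then show ?thesis unfolding phi_diff_K1_op(2)[OF k1 f y \<tau> k] by (simp add: mult_ac)
  qed
  moreover have "0 \<le> 2 * C * B" using B(1) C(1) by simp
  ultimately show ?thesis using K1_op_in_C0[OF k1 f] unfolding zygmund_iff[OF lam] by blast
qed

section \<open>Regularity of the solution\<close>

theorem theorem3p4:
  fixes \<mu> lam \<epsilon> s :: real
    and k m :: nat
    and k1 h :: "real \<Rightarrow> real \<Rightarrow> real"
    and \<psi> g fstar :: "real \<Rightarrow> real"
  assumes mu: "\<mu> > -1"
    and k1_cont: "continuous_on ({-1..1} \<times> {-1..1}) (\<lambda>(x, y). k1 x y)"
    and g: "g \<in> C0"
    and fstar_sol: "solves_eq (K_op k1 \<psi> \<mu> h) g fstar"
    and fstar_unique: "\<And>f. solves_eq (K_op k1 \<psi> \<mu> h) g f \<Longrightarrow> \<forall>x\<in>{-1..1}. f x = fstar x"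
    and h_cont: "continuous_on ({-1..1} \<times> UNIV) (\<lambda>(x, u). h x u)"
    and psi: "\<psi> \<in> C0"
    and lam: "lam > 0"
    and k: "real k > lam"
    and k1_zyg: "(SUP x\<in>{-1..1}. zyg_norm k lam (k1 x)) < \<infinity>"
    and eps: "0 < \<epsilon>" "\<epsilon> < 1"
    and s: "s = (if \<mu> = 0 then min lam (1 - \<epsilon>) else min lam (\<mu> + 1))"
    and m: "real m > s"
  shows "(\<forall>f\<in>C0. K_op k1 \<psi> \<mu> h f \<in> zygmund m s) \<and>
         (g \<in> zygmund m s \<longrightarrow> fstar \<in> zygmund m s)"
proof -
  have s0: "0 < s" "s \<le> lam" using mu lam eps by (auto simp: s)
  have s1: "if \<mu> = 0 then s < 1 else s \<le> \<mu> + 1" using eps by (auto simp: s)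
  have "real k > 0" "real m > 0" using lam k s0 m by linarith+
  then have "0 < k" "0 < m" by simp_all
  have K: "K_op k1 \<psi> \<mu> h f \<in> zygmund m s" if f: "f \<in> C0" for f
  proof (rule zygmund_add_cong)
    have "K1_op k1 f \<in> zygmund k lam"
      using k1_cont k1_zyg f less_imp_le[OF lam] \<open>0 < k\<close> by (rule K1_op_in_zygmund)
    then have "K1_op k1 f \<in> zygmund k s" 
      using less_imp_le[OF s0(1)] s0(2) \<open>0 < k\<close> by (rule zygmund_mono)
    then show "K1_op k1 f \<in> zygmund m s" using s0(1) m \<open>0 < k\<close> by (rule zygmund_change_order)
    show "Ktilde_op \<psi> \<mu> (H_op h f) \<in> zygmund m s"
      using psi H_op_in_C0[OF h_cont f] s0(1) m s1 by (rule Ktilde_op_in_zygmund)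
  qed (use s0 \<open>0 < m\<close> in \<open>simp_all add: K_op_def\<close>)
  have "fstar \<in> zygmund m s" if "g \<in> zygmund m s"
  proof (rule zygmund_add_cong)
    show "K_op k1 \<psi> \<mu> h fstar \<in> zygmund m s" using fstar_sol by (intro K) (simp add: solves_eq_def)
    show "fstar y = K_op k1 \<psi> \<mu> h fstar y + g y" if "y \<in> {-1..1}" for y
      using fstar_sol that by (auto simp: solves_eq_def algebra_simps)
  qed (use that s0 \<open>0 < m\<close> in auto)
  with K show ?thesis by blast
qed

end
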